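(* Let $\lambda\ge 1$ and $n\ge 2$ be integers, and let $\lambda K_n$ be the complete multigraph on $n$ vertices with exactly $\lambda$ edges joining each pair of distinct vertices. If $n\neq 4$, then $$h_t(\lambda K_n)=(\lambda-1)\left(2\left\lceil \tfrac{n}{2}\right\rceil-1\right)+\left\lceil \tfrac{3n}{2}\right\rceil ,$$ and $h_t(\lambda K_4)=3\lambda+4$.
   Context: Multigraphs are finite and loopless; several parallel edges may join the same pair of vertices. A total colouring of a multigraph $\mathcal{G}$ is an assignment of colours to both the vertices and the edges of $\mathcal{G}$ (from a common set of colours) such that adjacent vertices receive different colours, adjacent edges (distinct edges sharing at least one endpoint, in particular parallel edges) receive different colours, and every edge receives a colour different from the colours of its end vertices. A harmonious total colouring of $\mathcal{G}$ is a total colouring $c$ with the additional property that, when for each incident pair $(v,e)$ of a vertex $v$ and an edge $e$ one writes the unordered pair of colours $\{c(v),c(e)\}$, each unordered pair of colours occurs at most once; that is, for distinct incident pairs $(v,e)\ne(w,f)$ one has $\{c(v),c(e)\}\neq\{c(w),c(f)\}$. The harmonious total chromatic number $h_t(\mathcal{G})$ is the smallest number of colours in a harmonious total colouring of $\mathcal{G}$. *)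

theory Defs
  imports Complex_Main
begin

text \<open>
  Edges are abstract objects carrying a two-element set of end vertices, so that parallel edges are
  distinct edges with the same ends.
\<close>

record ('v, 'e) multigraph =
  verts :: "'v set"
  edges :: "'e set"
  ends :: "'e \<Rightarrow> 'v set"

definition is_multigraph :: "('v, 'e) multigraph \<Rightarrow> bool" where
  "is_multigraph G \<longleftrightarrow>
     finite (verts G) \<and> finite (edges G) \<and>
     (\<forall>e\<in>edges G. ends G e \<subseteq> verts G \<and> card (ends G e) = 2)"

definition complete_multigraph :: "nat \<Rightarrow> nat \<Rightarrow> ('v, 'e) multigraph \<Rightarrow> bool" where
  "complete_multigraph l n G \<longleftrightarrow>
     is_multigraph G \<and> card (verts G) = n \<and>
     (\<forall>u\<in>verts G. \<forall>v\<in>verts G. u \<noteq> v \<longrightarrow> card {e \<in> edges G. ends G e = {u, v}} = l)"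

definition adjacent_vertices :: "('v, 'e) multigraph \<Rightarrow> 'v \<Rightarrow> 'v \<Rightarrow> bool" where
  "adjacent_vertices G u v \<longleftrightarrow> u \<noteq> v \<and> (\<exists>e\<in>edges G. ends G e = {u, v})"

definition adjacent_edges :: "('v, 'e) multigraph \<Rightarrow> 'e \<Rightarrow> 'e \<Rightarrow> bool" where
  "adjacent_edges G e f \<longleftrightarrow>
     e \<in> edges G \<and> f \<in> edges G \<and> e \<noteq> f \<and> ends G e \<inter> ends G f \<noteq> {}"

definition incident_pairs :: "('v, 'e) multigraph \<Rightarrow> ('v \<times> 'e) set" where
  "incident_pairs G = {(v, e). v \<in> verts G \<and> e \<in> edges G \<and> v \<in> ends G e}"

text \<open>
  A total colouring is a function on the disjoint sum of vertices and edges; only its values on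
  \<open>verts G <+> edges G\<close> matter.
\<close>

definition total_colouring :: "('v, 'e) multigraph \<Rightarrow> ('v + 'e \<Rightarrow> 'c) \<Rightarrow> bool" where
  "total_colouring G c \<longleftrightarrow>
     (\<forall>u v. adjacent_vertices G u v \<longrightarrow> c (Inl u) \<noteq> c (Inl v)) \<and>
     (\<forall>e f. adjacent_edges G e f \<longrightarrow> c (Inr e) \<noteq> c (Inr f)) \<and>
     (\<forall>(v, e)\<in>incident_pairs G. c (Inl v) \<noteq> c (Inr e))"

definition harmonious_total_colouring ::
    "('v, 'e) multigraph \<Rightarrow> ('v + 'e \<Rightarrow> 'c) \<Rightarrow> bool" where
  "harmonious_total_colouring G c \<longleftrightarrow>
     total_colouring G c \<and>
     (\<forall>(v, e)\<in>incident_pairs G. \<forall>(w, f)\<in>incident_pairs G.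
        (v, e) \<noteq> (w, f) \<longrightarrow> {c (Inl v), c (Inr e)} \<noteq> {c (Inl w), c (Inr f)})"

definition harmonious_total_chromatic_number :: "('v, 'e) multigraph \<Rightarrow> nat" where
  "harmonious_total_chromatic_number G =
     (LEAST k. \<exists>c :: 'v + 'e \<Rightarrow> nat.
        harmonious_total_colouring G c \<and> card (c ` (verts G <+> edges G)) = k)"

text \<open>
  Every multigraph has a harmonious total colouring, so the minimum above is over a nonempty set.
\<close>

lemma harmonious_total_colouring_exists:
  assumes "is_multigraph G"
  shows "\<exists>c :: 'v + 'e \<Rightarrow> nat. harmonious_total_colouring (G :: ('v, 'e) multigraph) c"
proof -
  have "finite (verts G <+> edges G)"
    using assms by (simp add: is_multigraph_def)
  then obtain c :: "'v + 'e \<Rightarrow> nat" where inj: "inj_on c (verts G <+> edges G)"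
    using finite_imp_inj_to_nat_seg by blast
  have eq: "c x = c y \<longleftrightarrow> x = y" if "x \<in> verts G <+> edges G" "y \<in> verts G <+> edges G" for x y
    using inj that by (auto dest: inj_onD)
  have verts: "u \<in> verts G" "v \<in> verts G" if "adjacent_vertices G u v" for u v
    using that assms by (auto simp: adjacent_vertices_def is_multigraph_def)
  have "total_colouring G c"
    unfolding total_colouring_def
    using verts by (auto simp: eq adjacent_edges_def incident_pairs_def InlI InrI)
      (auto simp: adjacent_vertices_def)
  then have "harmonious_total_colouring G c"
    unfolding harmonious_total_colouring_def
    by (auto simp: eq incident_pairs_def InlI InrI doubleton_eq_iff)
  then show ?thesis by blast
qed

lemma complete_multigraph_exists:
  "complete_multigraph l n
     \<lparr>verts = {..<n}, edges = {s. s \<subseteq> {..<n} \<and> card s = 2} \<times> {..<l}, ends = fst\<rparr>"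
proof -
  have "{e \<in> {s. s \<subseteq> {..<n} \<and> card s = 2} \<times> {..<l}. fst e = {u, v}} = {{u, v}} \<times> {..<l}"
    if "u < n" "v < n" "u \<noteq> v" for u v
    using that by auto
  then show ?thesis
    by (auto simp: complete_multigraph_def is_multigraph_def card_cartesian_product)
qed

end

theory Submission
  imports Defs
begin

text \<open>
All vertices of \<open>G\<close> are adjacent, so they use \<open>n\<close> different colours, and the question is how many fresh
colours, not used on vertices, the edges need. Write \<open>w \<rightarrow> v\<close> if some edge at \<open>v\<close> has the colour of the vertex
\<open>w\<close>. A proper total colouring is harmonious iff this relation is asymmetric: \<open>w \<rightarrow> v\<close> and \<open>v \<rightarrow> w\<close> together
would give the pair of the colours of \<open>v\<close> and \<open>w\<close> twice.

For the lower bound, count the pairs of a vertex and a colour of an edge at it. There are \<open>n * (n - 1) * l\<close> of them. A fresh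
colour is responsible for at most \<open>2 * (n div 2)\<close>, its edges being disjoint, and all vertex colours together for
at most \<open>n * (n - 1) / 2\<close>, by asymmetry. Rounding gives the formula (\<open>colour_incidence.degree_bound\<close>,
\<open>fresh_colours_bound\<close>). For \<open>n = 4\<close> the count allows one colour too few; there the parity of the sets
\<open>{v. w \<rightarrow> v}\<close>, which are unions of disjoint edges, is decisive
(\<open>colour_incidence.four_vertices_bound\<close>).

For the upper bound, \<open>l - 1\<close> of the \<open>l\<close> parallel copies of \<open>K\<^sub>n\<close> are coloured with private fresh colours, as few as a
proper edge colouring of \<open>K\<^sub>n\<close> permits. The remaining copy needs a colouring with the \<open>n\<close> vertex colours and only
\<open>(n + 1) div 2\<close> fresh ones (\<open>ex_harmonious_design\<close>). Such a colouring exists for every \<open>n \<ge> 2\<close> except \<open>4\<close>. The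
constructions put the vertices on a circle or two, possibly with one more vertex, and let a vertex
colour nested chords of the half circle that follows it; this makes \<open>\<rightarrow>\<close> asymmetric and leaves a nearly regular graph that splits into the right number of
matchings. Parity forces a separate arrangement for each residue of \<open>n\<close> modulo \<open>4\<close>. For \<open>n = 4\<close> all copies
are coloured with private colours, three for each copy.
\<close>

section \<open>Counting incidences of vertices and colours\<close>

lemma sum_card_filter_swap:
  assumes "finite A" "finite B"
  shows "(\<Sum>a\<in>A. card {b\<in>B. R a b}) = (\<Sum>b\<in>B. card {a\<in>A. R a b})"
  using sum.swap_restrict[OF assms, of "\<lambda>_ _. 1 :: nat" R] by simp

text \<open>
Out-degree plus in-degree of a vertex of an oriented graph is at most the number of other vertices.
\<close>

lemma card_oriented_pairs_le:
  fixes D :: "'v \<Rightarrow> 'v \<Rightarrow> bool"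
  assumes "finite V" and asym: "\<And>v w. v \<in> V \<Longrightarrow> w \<in> V \<Longrightarrow> D w v \<Longrightarrow> \<not> D v w"
  shows "2 * (\<Sum>w\<in>V. card {v\<in>V. D w v}) \<le> card V * (card V - 1)"
proof -
  have irrefl: "\<not> D v v" if "v \<in> V" for v using asym that by blast
  have inout: "card {v\<in>V. D w v} + card {v\<in>V. D v w} \<le> card V - 1" if w: "w \<in> V" for w
  proof -
    have "card {v\<in>V. D w v} + card {v\<in>V. D v w} = card ({v\<in>V. D w v} \<union> {v\<in>V. D v w})"
      using asym w \<open>finite V\<close> by (intro card_Un_disjoint[symmetric]) auto
    also have "\<dots> \<le> card (V - {w})" using irrefl w \<open>finite V\<close> by (intro card_mono) auto
    finally show ?thesis using w \<open>finite V\<close> by simp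
  qed
  have "2 * (\<Sum>w\<in>V. card {v\<in>V. D w v}) =
      (\<Sum>w\<in>V. card {v\<in>V. D w v} + card {v\<in>V. D v w})"
    using sum_card_filter_swap[OF \<open>finite V\<close> \<open>finite V\<close>, of D] by (simp add: sum.distrib)
  also have "\<dots> \<le> (\<Sum>w\<in>V. card V - 1)" using inout by (intro sum_mono)
  finally show ?thesis by simp
qed

text \<open>
What the lower bound sees of a colouring: \<open>F\<close> consists of the colours that no vertex has, \<open>P v f\<close> says that
an edge at \<open>v\<close> has the fresh colour \<open>f\<close>, and \<open>D w v\<close> that an edge at \<open>v\<close> has the colour of the vertex
\<open>w\<close>. The two parity assumptions hold because the edges of one colour form a matching. The assumption
\<open>asym\<close> is harmony: two vertices that each meet an edge in the other's colour would
produce the same unordered pair of colours twice. It also makes \<open>D\<close> irreflexive.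
\<close>

locale colour_incidence =
  fixes V :: "'v set" and F :: "'f set" and P :: "'v \<Rightarrow> 'f \<Rightarrow> bool" and D :: "'v \<Rightarrow> 'v \<Rightarrow> bool"
    and d :: nat
  assumes finV: "finite V" and finF: "finite F"
    and even_fresh: "f \<in> F \<Longrightarrow> even (card {v\<in>V. P v f})"
    and even_out: "w \<in> V \<Longrightarrow> even (card {v\<in>V. D w v})"
    and asym: "v \<in> V \<Longrightarrow> w \<in> V \<Longrightarrow> D w v \<Longrightarrow> \<not> D v w"
    and degree: "v \<in> V \<Longrightarrow> card {f\<in>F. P v f} + card {w\<in>V. D w v} = d"
begin

lemma degree_sum:
  "card V * d = (\<Sum>f\<in>F. card {v\<in>V. P v f}) + (\<Sum>w\<in>V. card {v\<in>V. D w v})"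
proof -
  have "card V * d = (\<Sum>v\<in>V. card {f\<in>F. P v f} + card {w\<in>V. D w v})"
    using degree by simp
  also have "\<dots> = (\<Sum>f\<in>F. card {v\<in>V. P v f}) + (\<Sum>w\<in>V. card {v\<in>V. D w v})"
    by (simp add: sum.distrib sum_card_filter_swap[OF finV finF]
        sum_card_filter_swap[OF finV finV, of "\<lambda>v w. D w v"])
  finally show ?thesis .
qed

text \<open>
Doubled so as to stay within the natural numbers: every fresh colour covers at most the
largest even number of vertices, and the vertex colours contribute at most one incidence for each pair
of vertices.
\<close>

lemma degree_bound:
  "2 * (card V * d) \<le> 4 * (card V div 2) * card F + card V * (card V - 1)"
proof -
  have "card {v\<in>V. P v f} \<le> 2 * (card V div 2)" if "f \<in> F" for f
  proof -
    have "card {v\<in>V. P v f} \<le> card V" using finV by (intro card_mono) auto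
    moreover obtain k where "card {v\<in>V. P v f} = 2 * k" using even_fresh[OF \<open>f \<in> F\<close>] by (elim evenE)
    ultimately show ?thesis by (simp add: less_eq_div_iff_mult_less_eq)
  qed
  then have "(\<Sum>f\<in>F. card {v\<in>V. P v f}) \<le> (\<Sum>f\<in>F. 2 * (card V div 2))" by (intro sum_mono)
  then have "(\<Sum>f\<in>F. card {v\<in>V. P v f}) \<le> 2 * (card V div 2) * card F" by (simp add: mult.commute)
  moreover have "2 * (\<Sum>w\<in>V. card {v\<in>V. D w v}) \<le> card V * (card V - 1)"
    by (rule card_oriented_pairs_le[OF finV asym])
  ultimately show ?thesis
    using degree_sum by linarith
qed

text \<open>
On four vertices \<open>degree_bound\<close> misses the truth by one. With only \<open>3 * l - 1\<close> fresh colours every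
vertex has positive in-degree in \<open>D\<close>; as degrees in an orientation of \<open>K\<^sub>4\<close> sum to at most \<open>3\<close> and
out-degrees are even, every out-degree is \<open>0\<close> or \<open>2\<close>, and the set \<open>S\<close> of vertices of out-degree \<open>2\<close> has
two, three or four elements, each of in-degree \<open>1\<close>. All three sizes are impossible.
\<close>

lemma four_vertices_bound:
  assumes "card V = 4" "d = 3 * l"
  shows "3 * l \<le> card F"
proof (rule ccontr)
  assume "\<not> 3 * l \<le> card F"
  then have few: "card F + 1 \<le> 3 * l" by simp
  let ?in = "\<lambda>v. card {w\<in>V. D w v}" and ?out = "\<lambda>w. card {v\<in>V. D w v}"
    and ?fresh = "\<lambda>v. card {f\<in>F. P v f}"
  have irrefl: "\<not> D v v" if "v \<in> V" for v using asym that by blast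
  have in_pos: "?in v \<ge> 1" if "v \<in> V" for v
  proof -
    have "?fresh v \<le> card F" using finF by (intro card_mono) auto
    then show ?thesis using degree[OF that] few assms by linarith
  qed
  have in_out: "?out v + ?in v \<le> 3" if "v \<in> V" for v
  proof -
    have "?out v + ?in v = card ({w\<in>V. D v w} \<union> {w\<in>V. D w v})"
      using asym that finV by (intro card_Un_disjoint[symmetric]) auto
    also have "\<dots> \<le> card (V - {v})" using irrefl that finV by (intro card_mono) auto
    finally show ?thesis using that finV assms by simp
  qed
  define S where "S = {v\<in>V. ?out v = 2}"
  have S: "S \<subseteq> V" "finite S" using finV by (auto simp: S_def)
  have out_cases: "?out v = (if v \<in> S then 2 else 0)" if v: "v \<in> V" for v
  proof -
    obtain k where "?out v = 2 * k" using even_out[OF v] by (elim evenE)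
    moreover have "?out v \<le> 2" using in_out[OF v] in_pos[OF v] by linarith
    ultimately show ?thesis using v by (auto simp: S_def)
  qed
  have in_S: "?in v = 1" if "v \<in> S" for v
    using in_out[of v] in_pos[of v] that S by (force simp: S_def)
  have "(\<Sum>v\<in>V. ?in v) = (\<Sum>v\<in>V. ?out v)" by (rule sum_card_filter_swap[OF finV finV])
  also have "\<dots> = (\<Sum>v\<in>V. if v \<in> S then 2 else 0)" by (intro sum.cong refl out_cases)
  also have "\<dots> = 2 * card S" using S finV by (simp add: sum.If_cases Int_absorb1)
  finally have sum_in: "(\<Sum>v\<in>V. ?in v) = 2 * card S" .
  have split: "(\<Sum>v\<in>V. ?in v) = card S + (\<Sum>v\<in>V - S. ?in v)"
    using sum.subset_diff[OF S(1) finV, of ?in] in_S by simp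
  have card_rest: "card (V - S) = 4 - card S" using S finV assms by (simp add: card_Diff_subset)
  have "card S \<le> 4" using S finV assms card_mono by metis
  have rest_pos: "card (V - S) \<le> (\<Sum>v\<in>V - S. ?in v)"
    using sum_mono[of "V - S" "\<lambda>_. 1" ?in] in_pos by simp
  consider "card S = 2" | "card S = 3" | "card S = 4"
    using sum_in split rest_pos card_rest \<open>card S \<le> 4\<close> by linarith
  then show False
  proof cases
    case 1
    then obtain x y where xy: "S = {x, y}" "x \<noteq> y" by (auto simp: card_2_iff)
    \<comment> \<open>Only members of \<open>S\<close> have out-neighbours, so the two members would have to reach each other.\<close>
    have reached: "\<exists>w\<in>S. w \<noteq> v \<and> D w v" if "v \<in> S" for v
    proof -
      have "v \<in> V" using that S by blast
      then obtain w where w: "w \<in> V" "D w v" using in_pos by (force simp: Suc_le_eq card_gt_0_iff)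
      then have "{u\<in>V. D w u} \<noteq> {}" using \<open>v \<in> V\<close> by blast
      then have "?out w \<noteq> 0" using finV by (simp add: card_eq_0_iff)
      then have "w \<in> S" using out_cases[OF w(1)] by presburger
      then show ?thesis using w irrefl[OF \<open>v \<in> V\<close>] by (intro bexI[of _ w]) auto
    qed
    have "D y x" "D x y" using reached[of x] reached[of y] xy by auto
    then show False using asym[of x y] xy S by auto
  next
    case 2
    then have "card (V - S) = 1" using card_rest by simp
    then obtain z where z: "V - S = {z}" by (auto simp: card_1_singleton_iff)
    then have "z \<in> V" by blast
    \<comment> \<open>The vertex outside \<open>S\<close> absorbs all the remaining in-degree, so only \<open>3 * l - 3\<close> fresh colours occur
      at it. By parity every other fresh colour covers at most two vertices, which leaves too few incidences.\<close>
    have "?in z = 3" using split sum_in 2 z by simp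
    then have fresh_z: "?fresh z + 3 = 3 * l" using degree[OF \<open>z \<in> V\<close>] assms by simp
    have col: "card {v\<in>V. P v f} \<le> 2 + 2 * of_bool (P z f)" if "f \<in> F" for f
    proof -
      obtain k where k: "card {v\<in>V. P v f} = 2 * k" using even_fresh[OF \<open>f \<in> F\<close>] by (elim evenE)
      have "{v\<in>V. P v f} \<subseteq> (if P z f then V else V - {z})" by auto
      then have "card {v\<in>V. P v f} \<le> card (if P z f then V else V - {z})"
        using finV by (intro card_mono) auto
      then have "2 * k \<le> (if P z f then 4 else 3)" using k assms \<open>z \<in> V\<close> finV by (auto split: if_splits)
      then show ?thesis unfolding k by (cases "P z f") simp_all
    qed
    have "(\<Sum>f\<in>F. card {v\<in>V. P v f}) \<le> (\<Sum>f\<in>F. 2 + 2 * of_bool (P z f))"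
      using col by (rule sum_mono)
    also have "\<dots> = 2 * card F + 2 * ?fresh z"
      using finF by (simp only: sum.distrib sum_distrib_left[symmetric] sum_of_bool_eq) (simp add: Int_def)
    finally have "(\<Sum>f\<in>F. card {v\<in>V. P v f}) \<le> 2 * card F + 2 * ?fresh z" .
    moreover have "card V * d = (\<Sum>f\<in>F. card {v\<in>V. P v f}) + 6"
      using degree_sum sum_in 2 sum_card_filter_swap[OF finV finV, of D] by simp
    ultimately show False using fresh_z few assms by simp
  next
    case 3
    then have "V - S = {}" using card_rest finV by simp
    then have "(\<Sum>v\<in>V - S. ?in v) = 0" by (simp only: sum.empty)
    then show False using split sum_in 3 by linarith
  qed
qed

end

lemma card_edges_at_vertex:
  assumes "complete_multigraph l n G" "v \<in> verts G"
  shows "card {e\<in>edges G. v \<in> ends G e} = (n - 1) * l"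
proof -
  have fin: "finite (verts G)" "finite (edges G)" and n: "card (verts G) = n"
    and ends: "\<And>e. e \<in> edges G \<Longrightarrow> ends G e \<subseteq> verts G \<and> card (ends G e) = 2"
    and par: "\<And>u. u \<in> verts G \<Longrightarrow> u \<noteq> v \<Longrightarrow> card {e \<in> edges G. ends G e = {u, v}} = l"
    using assms by (auto simp: complete_multigraph_def is_multigraph_def)
  have "{e\<in>edges G. v \<in> ends G e} = (\<Union>u\<in>verts G - {v}. {e\<in>edges G. ends G e = {u, v}})"
  proof (intro equalityI subsetI)
    fix e assume "e \<in> {e\<in>edges G. v \<in> ends G e}"
    then have e: "e \<in> edges G" "v \<in> ends G e" by auto
    then obtain a b where "ends G e = {a, b}" "a \<noteq> b" using ends[OF e(1)] unfolding card_2_iff by blast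
    then have "\<exists>u\<in>verts G - {v}. ends G e = {u, v}" using e ends[of e] by auto
    then show "e \<in> (\<Union>u\<in>verts G - {v}. {e\<in>edges G. ends G e = {u, v}})" using e by blast
  qed auto
  also have "card \<dots> = (\<Sum>u\<in>verts G - {v}. card {e\<in>edges G. ends G e = {u, v}})"
    using fin by (intro card_UN_disjoint) (auto simp: doubleton_eq_iff)
  also have "\<dots> = (n - 1) * l" using par n assms fin by simp
  finally show ?thesis .
qed

lemma complete_multigraph_adjacent:
  assumes "complete_multigraph l n G" "l \<ge> 1" "u \<in> verts G" "v \<in> verts G" "u \<noteq> v"
  shows "adjacent_vertices G u v"
proof -
  have "card {e \<in> edges G. ends G e = {u, v}} \<noteq> 0" using assms by (auto simp: complete_multigraph_def)
  then have "{e \<in> edges G. ends G e = {u, v}} \<noteq> {}" by (metis card.empty)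
  then show ?thesis using assms by (auto simp: adjacent_vertices_def)
qed

text \<open>
The colours at \<open>v\<close> are in bijection with the edges at \<open>v\<close>; splitting them into fresh colours and colours
of vertices yields the degree condition of the locale.
\<close>

lemma colour_incidence_of_colouring:
  fixes G :: "('v, 'e) multigraph" and c :: "'v + 'e \<Rightarrow> 'c"
  assumes G: "complete_multigraph l n G" and "l \<ge> 1" and c: "harmonious_total_colouring G c"
  defines "F \<equiv> c ` (verts G <+> edges G) - c ` Inl ` verts G"
  shows "card (c ` (verts G <+> edges G)) = n + card F"
    and "colour_incidence (verts G) F
      (\<lambda>v f. \<exists>e\<in>edges G. v \<in> ends G e \<and> c (Inr e) = f)
      (\<lambda>w v. \<exists>e\<in>edges G. v \<in> ends G e \<and> c (Inr e) = c (Inl w)) ((n - 1) * l)"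
proof -
  let ?V = "verts G" and ?E = "edges G"
  have fin: "finite ?V" "finite ?E" and n: "card ?V = n"
    and ends: "\<And>e. e \<in> ?E \<Longrightarrow> ends G e \<subseteq> ?V \<and> card (ends G e) = 2"
    using G by (auto simp: complete_multigraph_def is_multigraph_def)
  have inj: "inj_on (\<lambda>v. c (Inl v)) ?V"
    using complete_multigraph_adjacent[OF G \<open>l \<ge> 1\<close>] c
    unfolding inj_on_def harmonious_total_colouring_def total_colouring_def by blast
  have edge_neq: "c (Inr e) \<noteq> c (Inr f)"
    if "e \<in> ?E" "f \<in> ?E" "e \<noteq> f" "v \<in> ends G e" "v \<in> ends G f" for e f v
    using c that unfolding harmonious_total_colouring_def total_colouring_def adjacent_edges_def by blast
  have vertex_edge_neq: "c (Inl v) \<noteq> c (Inr e)" if "v \<in> ends G e" "e \<in> ?E" for v e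
    using c that ends[of e]
    unfolding harmonious_total_colouring_def total_colouring_def incident_pairs_def by blast
  have no_swap: False
    if "e \<in> ?E" "f \<in> ?E" "v \<in> ends G e" "w \<in> ends G f" "c (Inr e) = c (Inl w)" "c (Inr f) = c (Inl v)"
    for e f v w
  proof -
    have inc: "(v, e) \<in> incident_pairs G" "(w, f) \<in> incident_pairs G"
      using that ends by (auto simp: incident_pairs_def)
    have "(v, e) \<noteq> (w, f)" using that vertex_edge_neq[of v e] by auto
    moreover have "{c (Inl v), c (Inr e)} = {c (Inl w), c (Inr f)}" using that by auto
    ultimately show False using c inc unfolding harmonious_total_colouring_def by blast
  qed
  have "finite (c ` (?V <+> ?E))" using fin by simp
  have card_cV: "card (c ` Inl ` ?V) = n" using inj n by (simp add: image_image card_image)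
  have sub: "c ` Inl ` ?V \<subseteq> c ` (?V <+> ?E)" by auto
  show "card (c ` (?V <+> ?E)) = n + card F"
    unfolding F_def using card_Diff_subset[OF finite_subset[OF sub] sub] card_mono[OF _ sub]
      card_cV \<open>finite (c ` (?V <+> ?E))\<close> by simp
  have even_class: "even (card {v\<in>?V. \<exists>e\<in>?E. v \<in> ends G e \<and> c (Inr e) = f})" for f
  proof -
    have "{v\<in>?V. \<exists>e\<in>?E. v \<in> ends G e \<and> c (Inr e) = f} = (\<Union>e\<in>{e\<in>?E. c (Inr e) = f}. ends G e)"
      using ends by blast
    also have "card \<dots> = (\<Sum>e\<in>{e\<in>?E. c (Inr e) = f}. card (ends G e))"
    proof (rule card_UN_disjoint)
      show "\<forall>e\<in>{e\<in>?E. c (Inr e) = f}. finite (ends G e)" using ends fin finite_subset by blast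
      show "\<forall>e\<in>{e\<in>?E. c (Inr e) = f}. \<forall>e'\<in>{e\<in>?E. c (Inr e) = f}. e \<noteq> e' \<longrightarrow> ends G e \<inter> ends G e' = {}"
      proof (intro ballI impI equals0I)
        fix e e' v
        assume "e \<in> {e\<in>?E. c (Inr e) = f}" "e' \<in> {e\<in>?E. c (Inr e) = f}" "e \<noteq> e'"
          "v \<in> ends G e \<inter> ends G e'"
        then show False using edge_neq[of e e' v] by simp
      qed
    qed (use fin in simp)
    also have "\<dots> = 2 * card {e\<in>?E. c (Inr e) = f}" using ends by simp
    finally show ?thesis by simp
  qed
  show "colour_incidence ?V F
      (\<lambda>v f. \<exists>e\<in>?E. v \<in> ends G e \<and> c (Inr e) = f)
      (\<lambda>w v. \<exists>e\<in>?E. v \<in> ends G e \<and> c (Inr e) = c (Inl w)) ((n - 1) * l)"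
  proof
    fix v assume v: "v \<in> ?V"
    let ?I = "{e\<in>?E. v \<in> ends G e}"
    let ?A = "{f\<in>F. \<exists>e\<in>?E. v \<in> ends G e \<and> c (Inr e) = f}"
    let ?B = "{w\<in>?V. \<exists>e\<in>?E. v \<in> ends G e \<and> c (Inr e) = c (Inl w)}"
    have "(\<lambda>e. c (Inr e)) ` ?I = ?A \<union> (\<lambda>w. c (Inl w)) ` ?B"
    proof (intro equalityI subsetI)
      fix k assume "k \<in> (\<lambda>e. c (Inr e)) ` ?I"
      then obtain e where e: "e \<in> ?E" "v \<in> ends G e" "k = c (Inr e)" by blast
      then have "k \<in> c ` (?V <+> ?E)" by blast
      show "k \<in> ?A \<union> (\<lambda>w. c (Inl w)) ` ?B"
      proof (cases "k \<in> c ` Inl ` ?V")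
        case True
        then show ?thesis using e by auto
      next
        case False
        then have "k \<in> F" using \<open>k \<in> c ` (?V <+> ?E)\<close> by (simp add: F_def)
        then show ?thesis using e by blast
      qed
    next
      fix k assume "k \<in> ?A \<union> (\<lambda>w. c (Inl w)) ` ?B"
      then obtain e where "e \<in> ?I" "k = c (Inr e)" by auto
      then show "k \<in> (\<lambda>e. c (Inr e)) ` ?I" by blast
    qed
    then have "card ((\<lambda>e. c (Inr e)) ` ?I) = card ?A + card ((\<lambda>w. c (Inl w)) ` ?B)"
    proof (simp only:, intro card_Un_disjoint)
      show "finite ?A" using fin by (simp add: F_def)
      show "finite ((\<lambda>w. c (Inl w)) ` ?B)" using fin by simp
      show "?A \<inter> (\<lambda>w. c (Inl w)) ` ?B = {}" by (auto simp: F_def)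
    qed
    moreover have "inj_on (\<lambda>e. c (Inr e)) ?I"
    proof (rule inj_onI)
      fix e f assume "e \<in> ?I" "f \<in> ?I" "c (Inr e) = c (Inr f)"
      then show "e = f" using edge_neq[of e f v] by blast
    qed
    moreover have "inj_on (\<lambda>w. c (Inl w)) ?B" using inj by (rule inj_on_subset) auto
    ultimately show "card ?A + card ?B = (n - 1) * l"
      using card_edges_at_vertex[OF G v] by (simp add: card_image)
  next
    fix v w
    assume "\<exists>e\<in>?E. v \<in> ends G e \<and> c (Inr e) = c (Inl w)"
    then show "\<not> (\<exists>e\<in>?E. w \<in> ends G e \<and> c (Inr e) = c (Inl v))" using no_swap by blast
  qed (use fin even_class F_def in simp_all)
qed

section \<open>Harmonious edge colourings of complete graphs\<close>

text \<open>
A harmonious colouring of the edges of the complete graph on \<open>V\<close>, in relational form: \<open>A w x y\<close> says that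
the edge \<open>xy\<close> may get the colour of the vertex \<open>w\<close>, and \<open>B s x y\<close> that it may get the fresh colour \<open>s\<close>.
An edge may be offered several colours. This costs nothing, since the matching conditions and the last
two conditions survive any choice among them, and it frees the constructions from proving uniqueness.
The case \<open>A = (\<lambda>_ _ _. False)\<close> is an ordinary proper edge colouring.
\<close>

definition harmonious_design ::
    "'a set \<Rightarrow> 'b set \<Rightarrow> ('a \<Rightarrow> 'a \<Rightarrow> 'a \<Rightarrow> bool) \<Rightarrow> ('b \<Rightarrow> 'a \<Rightarrow> 'a \<Rightarrow> bool) \<Rightarrow> bool" where
  "harmonious_design V F A B \<longleftrightarrow>
     (\<forall>x\<in>V. \<forall>y\<in>V. x \<noteq> y \<longrightarrow> (\<exists>w\<in>V. A w x y) \<or> (\<exists>s\<in>F. B s x y)) \<and>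
     (\<forall>w\<in>V. \<forall>x\<in>V. \<forall>y\<in>V. A w x y \<longrightarrow> A w y x) \<and>
     (\<forall>s\<in>F. \<forall>x\<in>V. \<forall>y\<in>V. B s x y \<longrightarrow> B s y x) \<and>
     (\<forall>w\<in>V. \<forall>x\<in>V. \<forall>y\<in>V. \<forall>z\<in>V. A w x y \<and> A w x z \<longrightarrow> y = z) \<and>
     (\<forall>s\<in>F. \<forall>x\<in>V. \<forall>y\<in>V. \<forall>z\<in>V. B s x y \<and> B s x z \<longrightarrow> y = z) \<and>
     (\<forall>w\<in>V. \<forall>y\<in>V. \<not> A w w y) \<and>
     (\<forall>w\<in>V. \<forall>x\<in>V. \<forall>y\<in>V. \<forall>z\<in>V. A w x y \<longrightarrow> \<not> A x w z)"

lemma harmonious_designI_linorder: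
  fixes V :: "'a :: linorder set"
  assumes cover: "\<And>x y. x \<in> V \<Longrightarrow> y \<in> V \<Longrightarrow> x < y \<Longrightarrow> (\<exists>w\<in>V. A w x y) \<or> (\<exists>s\<in>F. B s x y)"
    and symA: "\<And>w x y. w \<in> V \<Longrightarrow> x \<in> V \<Longrightarrow> y \<in> V \<Longrightarrow> A w x y \<Longrightarrow> A w y x"
    and symB: "\<And>s x y. s \<in> F \<Longrightarrow> x \<in> V \<Longrightarrow> y \<in> V \<Longrightarrow> B s x y \<Longrightarrow> B s y x"
    and "\<And>w x y z. w \<in> V \<Longrightarrow> x \<in> V \<Longrightarrow> y \<in> V \<Longrightarrow> z \<in> V \<Longrightarrow> A w x y \<Longrightarrow> A w x z \<Longrightarrow> y = z"
    and "\<And>s x y z. s \<in> F \<Longrightarrow> x \<in> V \<Longrightarrow> y \<in> V \<Longrightarrow> z \<in> V \<Longrightarrow> B s x y \<Longrightarrow> B s x z \<Longrightarrow> y = z"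
    and "\<And>w y. w \<in> V \<Longrightarrow> y \<in> V \<Longrightarrow> \<not> A w w y"
    and "\<And>w x y z. w \<in> V \<Longrightarrow> x \<in> V \<Longrightarrow> y \<in> V \<Longrightarrow> z \<in> V \<Longrightarrow> A w x y \<Longrightarrow> \<not> A x w z"
  shows "harmonious_design V F A B"
  unfolding harmonious_design_def
proof (intro conjI ballI impI)
  fix x y assume *: "x \<in> V" "y \<in> V" "x \<noteq> y"
  show "(\<exists>w\<in>V. A w x y) \<or> (\<exists>s\<in>F. B s x y)"
  proof (cases "x < y")
    case True
    with cover * show ?thesis by blast
  next
    case False
    with * have "(\<exists>w\<in>V. A w y x) \<or> (\<exists>s\<in>F. B s y x)" by (intro cover) auto
    then show ?thesis using symA[OF _ *(2,1)] symB[OF _ *(2,1)] by blast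
  qed
qed ((elim conjE)?, (rule assms; assumption))+

lemmas harmonious_design_cover =
    harmonious_design_def[THEN iffD1, THEN conjunct1, rule_format]
  and harmonious_design_sym_vertex =
    harmonious_design_def[THEN iffD1, THEN conjunct2, THEN conjunct1, rule_format]
  and harmonious_design_sym_fresh =
    harmonious_design_def[THEN iffD1, THEN conjunct2, THEN conjunct2, THEN conjunct1, rule_format]
  and harmonious_design_matching_vertex =
    harmonious_design_def[THEN iffD1, THEN conjunct2, THEN conjunct2, THEN conjunct2, THEN conjunct1,
      rule_format, OF _ _ _ _ _ conjI]
  and harmonious_design_matching_fresh =
    harmonious_design_def[THEN iffD1, THEN conjunct2, THEN conjunct2, THEN conjunct2, THEN conjunct2,
      THEN conjunct1, rule_format, OF _ _ _ _ _ conjI]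
  and harmonious_design_irrefl =
    harmonious_design_def[THEN iffD1, THEN conjunct2, THEN conjunct2, THEN conjunct2, THEN conjunct2,
      THEN conjunct2, THEN conjunct1, rule_format]
  and harmonious_design_asym =
    harmonious_design_def[THEN iffD1, THEN conjunct2, THEN conjunct2, THEN conjunct2, THEN conjunct2,
      THEN conjunct2, THEN conjunct2, rule_format]

lemma harmonious_design_transport:
  assumes D: "harmonious_design W F A B" and bij: "bij_betw h V W"
  shows "harmonious_design V F (\<lambda>w x y. A (h w) (h x) (h y)) (\<lambda>s x y. B s (h x) (h y))"
proof -
  have W: "h x \<in> W" if "x \<in> V" for x using bij that by (rule bij_betw_apply)
  have surj: "\<exists>v\<in>V. w = h v" if "w \<in> W" for w
    using bij that unfolding bij_betw_def by blast
  have inj: "x = y" if "h x = h y" "x \<in> V" "y \<in> V" for x y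
    using bij that by (auto simp: bij_betw_def inj_on_def)
  show ?thesis
    unfolding harmonious_design_def
  proof (intro conjI ballI impI)
    fix x y assume xy: "x \<in> V" "y \<in> V" "x \<noteq> y"
    then have "(\<exists>w\<in>W. A w (h x) (h y)) \<or> (\<exists>s\<in>F. B s (h x) (h y))"
      using harmonious_design_cover[OF D W W] inj by metis
    then show "(\<exists>w\<in>V. A (h w) (h x) (h y)) \<or> (\<exists>s\<in>F. B s (h x) (h y))"
      using surj by metis
  next
    fix w x y assume "w \<in> V" "x \<in> V" "y \<in> V" "A (h w) (h x) (h y)"
    then show "A (h w) (h y) (h x)" using harmonious_design_sym_vertex[OF D W W W] by simp
  next
    fix s x y assume "s \<in> F" "x \<in> V" "y \<in> V" "B s (h x) (h y)"
    then show "B s (h y) (h x)" using harmonious_design_sym_fresh[OF D _ W W] by simp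
  next
    fix w x y z
    assume "w \<in> V" "x \<in> V" "y \<in> V" "z \<in> V" and A: "A (h w) (h x) (h y) \<and> A (h w) (h x) (h z)"
    then have "h y = h z" using harmonious_design_matching_vertex[OF D W W W W] by metis
    then show "y = z" using inj \<open>y \<in> V\<close> \<open>z \<in> V\<close> by simp
  next
    fix s x y z
    assume "s \<in> F" "x \<in> V" "y \<in> V" "z \<in> V" and B: "B s (h x) (h y) \<and> B s (h x) (h z)"
    then have "h y = h z" using harmonious_design_matching_fresh[OF D _ W W W] by metis
    then show "y = z" using inj \<open>y \<in> V\<close> \<open>z \<in> V\<close> by simp
  next
    fix w y assume "w \<in> V" "y \<in> V"
    then show "\<not> A (h w) (h w) (h y)" using harmonious_design_irrefl[OF D W W] by simp
  next
    fix w x y z assume "w \<in> V" "x \<in> V" "y \<in> V" "z \<in> V" "A (h w) (h x) (h y)"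
    then show "\<not> A (h x) (h w) (h z)" using harmonious_design_asym[OF D W W W W] by metis
  qed
qed

lemma harmonious_design_of_card:
  fixes F :: "'f set"
  assumes "finite V" "card V = n"
    and "harmonious_design W F A B" "finite W" "card W = n" "finite F" "card F = k"
  shows "\<exists>F :: 'f set. \<exists>A B. finite F \<and> card F = k \<and> harmonious_design V F A B"
proof -
  obtain h where "bij_betw h V W" using assms finite_same_card_bij by metis
  from harmonious_design_transport[OF assms(3) this] assms(6,7) show ?thesis by blast
qed

section \<open>Round-robin factorisations\<close>

text \<open>
The classical one-factorisation of \<open>K\<^sub>q\<^sub>+\<^sub>1\<close> for odd \<open>q\<close>: edges among \<open>0, \<dots>, q - 1\<close> are coloured by their
sum modulo \<open>q\<close>, and \<open>q\<close> is joined to the vertex that the colour leaves uncovered. Deleting the vertex \<open>q\<close> gives an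
optimal edge colouring of \<open>K\<^sub>q\<close>.
\<close>

definition round_robin :: "int \<Rightarrow> int \<Rightarrow> int \<Rightarrow> int \<Rightarrow> bool" where
  "round_robin q s i j \<longleftrightarrow>
     (i < q \<and> j < q \<and> i \<noteq> j \<and> (i + j = s \<or> i + j = s + q)) \<or>
     (i < q \<and> j = q \<and> (2 * i = s \<or> 2 * i = s + q)) \<or>
     (i = q \<and> j < q \<and> (2 * j = s \<or> 2 * j = s + q))"

lemma round_robin_sym: "round_robin q s i j \<Longrightarrow> round_robin q s j i"
  by (auto simp: round_robin_def add.commute)

lemma round_robin_unique:
  assumes "odd q" "round_robin q s i j" "round_robin q s i k" "i \<in> {0..q}" "j \<in> {0..q}" "k \<in> {0..q}"
  shows "j = k"
proof (cases "i = q")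
  case True
  then have "(2 * j = s \<or> 2 * j = s + q) \<and> (2 * k = s \<or> 2 * k = s + q)"
    using assms by (auto simp: round_robin_def)
  moreover have "2 * j \<noteq> 2 * k + q" "2 * k \<noteq> 2 * j + q" using \<open>odd q\<close> by (metis dvd_triv_left even_add)+
  ultimately show ?thesis by linarith
next
  case False
  with assms(2-) show ?thesis unfolding round_robin_def atLeastAtMost_iff by (smt (verit))
qed

lemma round_robin_cover:
  assumes "odd q" "i \<in> {0..q}" "j \<in> {0..q}" "i \<noteq> j"
  shows "\<exists>s\<in>{0..<q}. round_robin q s i j"
proof -
  have "q > 0" using assms by (cases "q = 0") auto
  consider "i = q" | "j = q" | "i < q" "j < q" using assms by fastforce
  then show ?thesis
  proof cases
    case 1
    show ?thesis
      by (rule bexI[of _ "if 2 * j < q then 2 * j else 2 * j - q"])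
        (use 1 assms \<open>q > 0\<close> in \<open>auto simp: round_robin_def\<close>)
  next
    case 2
    show ?thesis
      by (rule bexI[of _ "if 2 * i < q then 2 * i else 2 * i - q"])
        (use 2 assms \<open>q > 0\<close> in \<open>auto simp: round_robin_def\<close>)
  next
    case 3
    show ?thesis
      by (rule bexI[of _ "if i + j < q then i + j else i + j - q"])
        (use 3 assms \<open>q > 0\<close> in \<open>auto simp: round_robin_def\<close>)
  qed
qed

lemma harmonious_design_round_robin:
  assumes "odd q" "V \<subseteq> {0..q}"
  shows "harmonious_design V {0..<q} (\<lambda>_ _ _. False) (round_robin q)"
proof (rule harmonious_designI_linorder)
  show "(\<exists>w\<in>V. False) \<or> (\<exists>s\<in>{0..<q}. round_robin q s x y)" if "x \<in> V" "y \<in> V" "x < y" for x y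
  proof -
    have "x \<in> {0..q}" "y \<in> {0..q}" "x \<noteq> y" using that assms(2) by auto
    then show ?thesis using round_robin_cover[OF \<open>odd q\<close>] by blast
  qed
  show "y = z" if "x \<in> V" "y \<in> V" "z \<in> V" "round_robin q s x y" "round_robin q s x z" for s x y z
    by (rule round_robin_unique[OF \<open>odd q\<close> that(4,5)]) (use that(1-3) assms(2) in blast)+
  show "round_robin q s y x" if "round_robin q s x y" for s x y
    using that by (rule round_robin_sym)
qed simp_all

text \<open>
The number of colours is \<open>n\<close> for odd \<open>n\<close> and \<open>n - 1\<close> for even \<open>n\<close>, where \<open>n\<close> is the size of \<open>V\<close>.
\<close>

lemma ex_one_factorisation:
  assumes "finite V" "card V \<ge> 1"
  shows "\<exists>S :: int set. \<exists>Q. finite S \<and> card S = 2 * ((card V + 1) div 2) - 1 \<and>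
    harmonious_design V S (\<lambda>_ _ _. False) Q"
proof -
  define q where "q = 2 * ((int (card V) + 1) div 2) - 1"
  have "odd q" by (simp add: q_def)
  obtain h where h: "bij_betw h V {0..<int (card V)}"
    using assms by (metis finite_same_card_bij card_atLeastLessThan_int diff_zero finite_atLeastLessThan_int nat_int)
  have "{0..<int (card V)} \<subseteq> {0..q}" by (auto simp: q_def)
  from harmonious_design_transport[OF harmonious_design_round_robin[OF \<open>odd q\<close> this] h]
  have "harmonious_design V {0..<q} (\<lambda>_ _ _. False) (\<lambda>s x y. round_robin q s (h x) (h y))" .
  moreover have "card {0..<q} = 2 * ((card V + 1) div 2) - 1"
    using assms by (simp add: q_def nat_diff_distrib nat_mult_distrib nat_div_distrib nat_add_distrib)
  ultimately show ?thesis by blast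
qed

section \<open>Distances on a circle\<close>

text \<open>
The clockwise distance from \<open>x\<close> to \<open>y\<close> on a circle with the points \<open>0, \<dots>, N - 1\<close>, as a case distinction
rather than a remainder so that it is open to linear arithmetic.
\<close>

definition arc :: "int \<Rightarrow> int \<Rightarrow> int \<Rightarrow> int" where
  "arc N x y = (if x \<le> y then y - x else y - x + N)"

lemma arc_self [simp]: "arc N x x = 0"
  by (simp add: arc_def)

lemma arc_swap: "x \<noteq> y \<Longrightarrow> arc N x y + arc N y x = N"
  by (simp add: arc_def)

lemma arc_right_inject:
  assumes "arc N w x = arc N w y" "x \<in> {0..<N}" "y \<in> {0..<N}"
  shows "x = y"
  using assms unfolding arc_def atLeastLessThan_iff by (smt (verit))

lemma arc_left_inject:
  assumes "arc N x w = arc N y w" "x \<in> {0..<N}" "y \<in> {0..<N}"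
  shows "x = y"
  using assms unfolding arc_def atLeastLessThan_iff by (smt (verit))

lemma cong_in_double_window:
  fixes p y z :: int
  assumes "p dvd y - z" "\<bar>y - z\<bar> < 2 * p"
  shows "y = z \<or> y = z + p \<or> y = z - p"
proof -
  obtain j where j: "y - z = p * j" using assms(1) by (auto elim: dvdE)
  have "p > 0" using assms(2) by auto
  have "\<bar>j\<bar> * p < 2 * p" using assms(2) j \<open>p > 0\<close> by (simp add: abs_mult mult.commute)
  then have "\<bar>j\<bar> < 2" using \<open>p > 0\<close> by (simp add: mult_less_cancel_right)
  then have "j = 0 \<or> j = 1 \<or> j = -1" by linarith
  then show ?thesis using j by auto
qed

section \<open>Orders congruent to 1 and 2 modulo 4\<close>

text \<open>
Take \<open>4 * t\<close> points on a circle and one further vertex, encoded as \<open>N\<close>. The vertex \<open>w\<close> colours the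
chords \<open>{w + i, w + 2 * t - i}\<close> of the half circle after \<open>w\<close>, and its fixed point \<open>w + t\<close> is joined to \<open>N\<close>;
the vertex \<open>N\<close> colours nothing. This accounts for all chords of even length except the diameters, and for all edges at
\<open>N\<close>. The chords of odd length form \<open>K\<^sub>2\<^sub>t\<^sub>,\<^sub>2\<^sub>t\<close>, which the \<open>2 * t\<close> odd sums split into perfect matchings, and the
diameters are one more.
\<close>

lemma harmonious_design_1_mod_4:
  fixes t N :: int
  assumes t: "t \<ge> 1" and N: "N = 4 * t"
  shows "harmonious_design {0..N} {0..2*t}
    (\<lambda>w x y. w \<noteq> N \<and>
       ((x \<noteq> N \<and> y \<noteq> N \<and> x \<noteq> y \<and> arc N w x \<ge> 1 \<and> arc N w y \<ge> 1 \<and> arc N w x + arc N w y = 2*t) \<or>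
        (x = N \<and> y \<noteq> N \<and> arc N w y = t) \<or> (y = N \<and> x \<noteq> N \<and> arc N w x = t)))
    (\<lambda>s x y. x \<noteq> N \<and> y \<noteq> N \<and>
       (if s = 2*t then \<bar>x - y\<bar> = 2*t else x + y = 2*s + 1 \<or> x + y = 2*s + 1 + N))"
    (is "harmonious_design ?V ?F ?A ?B")
proof (rule harmonious_designI_linorder)
  show "?A w y x" if "?A w x y" for w x y using that by auto
  show "?B s y x" if "?B s x y" for s x y using that by (auto simp: add.commute abs_minus_commute)
  show "(\<exists>w\<in>?V. ?A w x y) \<or> (\<exists>s\<in>?F. ?B s x y)" if "x \<in> ?V" "y \<in> ?V" "x < y" for x y
  proof (cases "y = N")
    case True
    define w where "w = (if x < t then x - t + N else x - t)"
    have "w \<in> ?V \<and> ?A w x y" using True that t N by (auto simp: w_def arc_def)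
    then show ?thesis by blast
  next
    case y: False
    show ?thesis
    proof (cases "even (y - x)")
      case False
      then have "odd (x + y)" by auto
      then obtain k where k: "x + y = 2*k + 1" by (elim oddE)
      define s where "s = (if k < 2*t then k else k - 2*t)"
      have "s \<in> ?F \<and> ?B s x y" using k y that t N by (auto simp: s_def)
      then show ?thesis by blast
    next
      case True
      then obtain k where k: "y - x = 2*k" by (elim evenE)
      consider "k < t" | "k = t" | "k > t" by linarith
      then show ?thesis
      proof cases
        case 1
        define w where "w = (if x < t - k then x - (t - k) + N else x - (t - k))"
        have "w \<in> ?V \<and> ?A w x y" using 1 k y that t N by (auto simp: w_def arc_def)
        then show ?thesis by blast
      next
        case 2
        then have "2*t \<in> ?F \<and> ?B (2*t) x y" using k y that t N by auto
        then show ?thesis by blast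
      next
        case 3
        define w where "w = y - (k - t)"
        have "w \<in> ?V \<and> ?A w x y" using 3 k y that t N by (auto simp: w_def arc_def)
        then show ?thesis by blast
      qed
    qed
  qed
  show "y = z" if "x \<in> ?V" "y \<in> ?V" "z \<in> ?V" "?A w x y" "?A w x z" for w x y z
  proof -
    have arc_eq: "u = v" if "u \<in> ?V" "v \<in> ?V" "u \<noteq> N" "v \<noteq> N" "arc N w u = arc N w v" for u v
      using that(5) by (rule arc_right_inject) (use that(1-4) in simp_all)
    have no_fixed: False
      if "u \<in> ?V" "u \<noteq> N" "x \<noteq> N" "u \<noteq> x" "arc N w x = t" "arc N w x + arc N w u = 2*t" for u
      using arc_eq[of u x] that \<open>x \<in> ?V\<close> by linarith
    show ?thesis
    proof (cases "x = N")
      case True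
      then have "y \<noteq> N" "z \<noteq> N" "arc N w y = arc N w z" using that(4,5) by simp_all
      then show ?thesis using arc_eq that(2,3) by blast
    next
      case x: False
      show ?thesis
      proof (cases "y = N \<or> z = N")
        case True
        then show ?thesis using x that no_fixed[of y] no_fixed[of z] by metis
      next
        case False
        then have "arc N w y = arc N w z" using x that(4,5) by simp
        then show ?thesis using arc_eq that(2,3) False by blast
      qed
    qed
  qed
  show "y = z" if "s \<in> ?F" "x \<in> ?V" "y \<in> ?V" "z \<in> ?V" "?B s x y" "?B s x z" for s x y z
  proof -
    have "0 \<le> x" "x < N" "0 \<le> y" "y < N" "0 \<le> z" "z < N" using that by auto
    with that(5,6) N show ?thesis by (cases "s = 2*t") auto
  qed
  show "\<not> ?A w w y" for w y using t by auto
  show "\<not> ?A x w z" if "?A w x y" for w x y z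
  proof
    assume "?A x w z"
    then have "arc N x w < 2*t" using t that by auto
    moreover have "x \<noteq> w" "arc N w x < 2*t" using t that \<open>?A x w z\<close> by auto
    ultimately show False using arc_swap[of w x N] N by auto
  qed
qed

text \<open>
Let \<open>2 * p\<close> points with \<open>p\<close> odd lie on a circle. The vertex \<open>w\<close> colours the chords \<open>{w + i, w + p - i}\<close>.
They lie in the open half circle that follows \<open>w\<close>, so no two vertices can reach each other, and over all \<open>w\<close>
they are the chords of odd length other than the diameters. The chords of even length form two copies
of \<open>K\<^sub>p\<close>, each properly coloured by the sum of the ends modulo \<open>p\<close>; as \<open>x\<close> and \<open>x + p\<close> miss the same
colour there, namely \<open>2 * x\<close> modulo \<open>p\<close>, the diameters fit into these \<open>p\<close> classes as well.
\<close>

lemma harmonious_design_2_mod_4: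
  fixes p t :: int
  assumes t: "t \<ge> 0" and p: "p = 2 * t + 1"
  shows "harmonious_design {0..<2*p} {0..<p}
    (\<lambda>w x y. arc (2*p) w x \<ge> 1 \<and> arc (2*p) w y \<ge> 1 \<and> arc (2*p) w x + arc (2*p) w y = p)
    (\<lambda>s x y. x \<noteq> y \<and> p dvd x + y - s \<and> (even (x - y) \<or> \<bar>x - y\<bar> = p))"
    (is "harmonious_design ?V ?F ?A ?B")
proof (rule harmonious_designI_linorder)
  have "odd p" "p > 0" using t p by auto
  show "?A w y x" if "?A w x y" for w x y using that by simp
  show "?B s y x" if "?B s x y" for s x y using that by (auto simp: add.commute abs_minus_commute)
  show "(\<exists>w\<in>?V. ?A w x y) \<or> (\<exists>s\<in>?F. ?B s x y)" if "x \<in> ?V" "y \<in> ?V" "x < y" for x y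
  proof (cases "even (x - y) \<or> \<bar>x - y\<bar> = p")
    case True
    then have "?B ((x + y) mod p) x y"
      using that by (auto simp: dvd_eq_mod_eq_0 mod_diff_right_eq)
    moreover have "(x + y) mod p \<in> ?F" using \<open>p > 0\<close> by simp
    ultimately show ?thesis by blast
  next
    case False
    then obtain k where k: "y - x = 2*k + 1" by (metis oddE even_minus minus_diff_eq)
    show ?thesis
    proof (cases "y - x < p")
      case True
      define w where "w = (if x < t - k then x - (t - k) + 2*p else x - (t - k))"
      have "?A w x y \<and> w \<in> ?V" using True k that p t
        by (auto simp: w_def arc_def)
      then show ?thesis by blast
    next
      case far: False
      define w where "w = y - (k - t)"
      have "?A w x y \<and> w \<in> ?V" using far False k that t
        by (auto simp: w_def arc_def p)
      then show ?thesis by blast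
    qed
  qed
  show "y = z" if "s \<in> ?F" "x \<in> ?V" "y \<in> ?V" "z \<in> ?V" "?B s x y" "?B s x z" for s x y z
  proof -
    have "p dvd (x + y - s) - (x + z - s)" using that dvd_diff by blast
    then have "p dvd y - z" by simp
    moreover have "\<bar>y - z\<bar> < 2 * p" using that(3,4) by auto
    ultimately have "y = z \<or> y = z + p \<or> y = z - p" by (rule cong_in_double_window)
    \<comment> \<open>If \<open>y\<close> and \<open>z\<close> were opposite, one of the two chords would have odd length and so be the diameter at
      \<open>x\<close>, which makes the other one degenerate.\<close>
    moreover have "\<not> (y = z + p \<or> y = z - p)"
    proof
      have bounds: "0 \<le> x" "0 \<le> y" "0 \<le> z" "x < 2 * p" "y < 2 * p" "z < 2 * p" "x \<noteq> y" "x \<noteq> z"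
        using that by auto
      assume yz: "y = z + p \<or> y = z - p"
      then have "odd (x - y) \<or> odd (x - z)" using \<open>odd p\<close> by auto
      then have "\<bar>x - y\<bar> = p \<or> \<bar>x - z\<bar> = p" using that(5,6) by blast
      then show False using yz bounds by linarith
    qed
    ultimately show ?thesis by blast
  qed
  show "y = z" if "y \<in> ?V" "z \<in> ?V" "?A w x y" "?A w x z" for w x y z
  proof (rule arc_right_inject)
    show "arc (2 * p) w y = arc (2 * p) w z" using that(3,4) by linarith
  qed (use that in simp_all)
  show "\<not> ?A w w y" for w y by simp
  show "\<not> ?A x w z" if "?A w x y" for w x y z
  proof -
    have "w \<noteq> x" "arc (2 * p) w x < p" using that by auto
    then show ?thesis using arc_swap[of w x "2 * p"] by linarith
  qed
qed

section \<open>Orders divisible by 4\<close>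

definition pair :: "'a \<Rightarrow> 'a \<Rightarrow> 'a \<Rightarrow> 'a \<Rightarrow> bool" where
  "pair a b x y \<longleftrightarrow> x = a \<and> y = b \<or> x = b \<and> y = a"

text \<open>
The chords of even length on a circle with \<open>2 * (q + 1)\<close> points: the round-robin factorisation, applied
separately to the even and to the odd points. The relative shift of the two by \<open>2\<close> places the edges
\<open>{0, 2 * q}\<close> and \<open>{q - 2, q}\<close> in one class, class \<open>0\<close>.
\<close>

definition doubled_round_robin :: "int \<Rightarrow> int \<Rightarrow> int \<Rightarrow> int \<Rightarrow> bool" where
  "doubled_round_robin q s x y \<longleftrightarrow>
     (even x \<and> even y \<and> round_robin q s (x div 2) (y div 2)) \<or>
     (odd x \<and> odd y \<and> round_robin q (if s < 2 then s + q - 2 else s - 2) (x div 2) (y div 2))"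

lemma doubled_round_robin_sym: "doubled_round_robin q s x y \<Longrightarrow> doubled_round_robin q s y x"
  by (auto simp: doubled_round_robin_def intro: round_robin_sym)

lemma doubled_round_robin_unique:
  assumes "odd q" "doubled_round_robin q s x y" "doubled_round_robin q s x z"
    and "x \<in> {0..2*q+1}" "y \<in> {0..2*q+1}" "z \<in> {0..2*q+1}"
  shows "y = z"
proof -
  have range: "u div 2 \<in> {0..q}" if "u \<in> {0..2*q+1}" for u using that by auto
  have "y div 2 = z div 2"
  proof (cases "even x")
    case True
    then have "round_robin q s (x div 2) (y div 2)" "round_robin q s (x div 2) (z div 2)"
      using assms(2,3) by (auto simp: doubled_round_robin_def)
    then show ?thesis using round_robin_unique \<open>odd q\<close> range assms(4-) by blast
  next
    case False
    let ?s = "if s < 2 then s + q - 2 else s - 2"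
    have "round_robin q ?s (x div 2) (y div 2)" "round_robin q ?s (x div 2) (z div 2)"
      using False assms(2,3) by (auto simp: doubled_round_robin_def)
    then show ?thesis using round_robin_unique \<open>odd q\<close> range assms(4-) by blast
  qed
  moreover have "even y \<longleftrightarrow> even z" using assms(2,3) by (auto simp: doubled_round_robin_def)
  ultimately show ?thesis by (metis even_two_times_div_two odd_two_times_div_two_succ)
qed

lemma doubled_round_robin_cover:
  assumes "odd q" "q \<ge> 2" "x \<in> {0..2*q+1}" "y \<in> {0..2*q+1}" "x \<noteq> y" "even (x - y)"
  shows "\<exists>s\<in>{0..<q}. doubled_round_robin q s x y"
proof -
  have par: "even x \<longleftrightarrow> even y" using assms by auto
  then have "x div 2 \<noteq> y div 2" using \<open>x \<noteq> y\<close> by (metis even_two_times_div_two odd_two_times_div_two_succ)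
  moreover have "x div 2 \<in> {0..q}" "y div 2 \<in> {0..q}" using assms by auto
  ultimately obtain s where s: "s \<in> {0..<q}" "round_robin q s (x div 2) (y div 2)"
    using round_robin_cover \<open>odd q\<close> by blast
  show ?thesis
  proof (cases "even x")
    case True
    then show ?thesis using s par by (auto simp: doubled_round_robin_def)
  next
    case False
    show ?thesis
      by (rule bexI[of _ "if s + 2 < q then s + 2 else s + 2 - q"])
        (use s par False \<open>q \<ge> 2\<close> in \<open>auto simp: doubled_round_robin_def\<close>)
  qed
qed

text \<open>
Let \<open>4 * t\<close> points lie on a circle. A vertex \<open>w\<close> of the first half, \<open>w < 2 * t\<close>, colours the \<open>t\<close> chords
\<open>{w + i, w + 2 * t + 1 - i}\<close> and thereby reaches \<open>w + 1, \<dots>, w + 2 * t\<close>. A vertex of the second half omits the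
outermost of them, \<open>{w + 1, w + 2 * t}\<close>, so that opposite vertices do not reach each other. The chords
of even length are two copies of \<open>K\<^sub>2\<^sub>t\<close>, coloured with \<open>q = 2 * t - 1\<close> fresh colours.

The omitted chords have to share the last fresh colour, \<open>q\<close>. They are \<open>{j, j + 2 * t + 1}\<close> for \<open>j < 2 * t - 1\<close>
together with \<open>{0, 2 * t - 1}\<close>, which is almost a perfect matching: it covers \<open>0\<close> twice and misses \<open>2 * t\<close>.
The chord \<open>{0, 2 * t - 1}\<close> is therefore given the fresh colour \<open>0\<close>. To make room, the chord \<open>{0, N - 2}\<close> of that class is
coloured by the vertex \<open>N - 1\<close>, whose way to \<open>0\<close> and \<open>N - 2\<close> is still free; \<open>{2 * t - 3, 2 * t - 1}\<close> moves from
class \<open>0\<close> to class \<open>q\<close>, and \<open>{2 * t - 3, N - 2}\<close> from class \<open>q\<close> to class \<open>0\<close>. The set \<open>S\<close> collects the four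
vertices at which class \<open>0\<close> is changed.
\<close>

lemma harmonious_design_0_mod_4:
  fixes t N q :: int
  assumes t: "t \<ge> 2" and N: "N = 4 * t" and q: "q = 2 * t - 1"
  defines "A \<equiv> \<lambda>w x y.
      (arc N w x \<ge> (if w < 2*t then 1 else 2) \<and> arc N w y \<ge> (if w < 2*t then 1 else 2) \<and>
       arc N w x + arc N w y = 2*t + 1) \<or>
      (w = N - 1 \<and> pair 0 (N - 2) x y)"
  defines "S \<equiv> {0, 2*t - 1, 2*t - 3, N - 2}"
  defines "B \<equiv> \<lambda>s x y.
      if s = q then
        ((x = y + (2*t + 1) \<or> y = x + (2*t + 1)) \<and> \<not> pair (2*t - 3) (N - 2) x y) \<or>
        pair (2*t - 3) (2*t - 1) x y
      else if s = 0 then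
        (x \<notin> S \<and> y \<notin> S \<and> doubled_round_robin q 0 x y) \<or>
        pair (2*t - 3) (N - 2) x y \<or> pair 0 (2*t - 1) x y
      else doubled_round_robin q s x y"
  shows "harmonious_design {0..<N} {0..q} A B"
    (is "harmonious_design ?V ?F _ _")
proof (rule harmonious_designI_linorder)
  have "odd q" by (simp add: q)
  have "q > 0" "q \<ge> 2" using q t by auto
  have V_eq: "?V = {0..2*q+1}" using N q by auto
  have arc_eq: "u = v" if "arc N w u = arc N w v" "u \<in> ?V" "v \<in> ?V" for u v w
    using that by (rule arc_right_inject)
  show "A w y x" if "A w x y" for w x y using that by (auto simp: A_def pair_def)
  show "B s y x" if "B s x y" for s x y
    using that doubled_round_robin_sym[of q s x y] doubled_round_robin_sym[of q 0 x y]
    by (auto simp: B_def pair_def split: if_splits)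
  \<comment> \<open>The four members of \<open>S\<close> are paired up by class \<open>0\<close> of the factorisation, so after the exchange each of
    them again has a single partner in class \<open>0\<close>.\<close>
  have special: "doubled_round_robin q 0 0 (N - 2)" "doubled_round_robin q 0 (2*t - 3) (2*t - 1)"
  proof -
    have "(N - 2) div 2 = q" using N q by auto
    then show "doubled_round_robin q 0 0 (N - 2)" using \<open>q > 0\<close> N
      by (auto simp: doubled_round_robin_def round_robin_def)
    have "(2*t - 3) div 2 = t - 2" "(2*t - 1) div 2 = t - 1" by auto
    then show "doubled_round_robin q 0 (2*t - 3) (2*t - 1)" using q t
      by (auto simp: doubled_round_robin_def round_robin_def)
  qed
  have S_V: "0 \<in> ?V" "N - 2 \<in> ?V" "2*t - 3 \<in> ?V" "2*t - 1 \<in> ?V" using N t by auto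
  have drr_unique: "y = z" if "doubled_round_robin q s x y" "doubled_round_robin q s x z"
    "x \<in> ?V" "y \<in> ?V" "z \<in> ?V" for s x y z
    by (rule doubled_round_robin_unique[OF \<open>odd q\<close> that(1,2)]) (use that(3-) V_eq in simp_all)
  have special_pair: "pair 0 (N - 2) x y \<or> pair (2*t - 3) (2*t - 1) x y"
    if "doubled_round_robin q 0 x y" "x \<in> S" "x \<in> ?V" "y \<in> ?V" for x y
  proof -
    have partner: "y = v" if "x = u" "doubled_round_robin q 0 u v" "v \<in> ?V" for u v
      using drr_unique[of 0 x y v] \<open>doubled_round_robin q 0 x y\<close> \<open>x \<in> ?V\<close> \<open>y \<in> ?V\<close> that by blast
    consider "x = 0" | "x = N - 2" | "x = 2*t - 3" | "x = 2*t - 1" using \<open>x \<in> S\<close> by (auto simp: S_def)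
    then show ?thesis
    proof cases
      case 1
      with partner special(1) S_V show ?thesis by (simp add: pair_def)
    next
      case 2
      with partner special(1)[THEN doubled_round_robin_sym] S_V show ?thesis by (simp add: pair_def)
    next
      case 3
      with partner special(2) S_V show ?thesis by (simp add: pair_def)
    next
      case 4
      with partner special(2)[THEN doubled_round_robin_sym] S_V show ?thesis by (simp add: pair_def)
    qed
  qed
  have pair_sym: "pair a b x y \<longleftrightarrow> pair a b y x" for a b x y :: int by (auto simp: pair_def)
  show "(\<exists>w\<in>?V. A w x y) \<or> (\<exists>s\<in>?F. B s x y)" if "x \<in> ?V" "y \<in> ?V" "x < y" for x y
  proof (cases "even (x - y)")
    case True
    with that have "\<exists>s\<in>{0..<q}. doubled_round_robin q s x y"
      by (intro doubled_round_robin_cover[OF \<open>odd q\<close> \<open>q \<ge> 2\<close>]) (simp_all add: V_eq[symmetric])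
    then obtain s where s: "s \<in> {0..<q}" "doubled_round_robin q s x y" by blast
    show ?thesis
    proof (cases "s = 0 \<and> (x \<in> S \<or> y \<in> S)")
      case True
      then have "pair 0 (N - 2) x y \<or> pair (2*t - 3) (2*t - 1) x y"
        using special_pair[OF _ _ that(1,2)] special_pair[OF _ _ that(2,1)]
          doubled_round_robin_sym[OF s(2)] pair_sym[of _ _ x y] s(2) by auto
      then show ?thesis
      proof
        assume "pair 0 (N - 2) x y"
        then have "A (N - 1) x y" by (simp add: A_def)
        moreover have "N - 1 \<in> ?V" using N t by auto
        ultimately show ?thesis by blast
      next
        assume "pair (2*t - 3) (2*t - 1) x y"
        then have "B q x y" by (simp add: B_def)
        then show ?thesis using \<open>q > 0\<close> by auto
      qed
    next
      case False
      then have "B s x y" using s by (auto simp: B_def)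
      then show ?thesis using s by auto
    qed
  next
    case False
    then have "odd (y - x)" by auto
    then obtain k where k: "y - x = 2*k + 1" by (elim oddE)
    show ?thesis
    proof (cases "k < t")
      case True
      show ?thesis
      \<comment> \<open>Here \<open>w\<close> precedes \<open>x\<close> by \<open>t - k\<close>. The chord is outermost for \<open>w\<close> iff \<open>k = t - 1\<close>, and then \<open>w\<close> lies in
        the second half only if \<open>x = 0\<close>, as otherwise \<open>y\<close> would exceed \<open>N - 1\<close>.\<close>
      proof (cases "x = 0 \<and> k = t - 1")
        case True
        then have "B 0 x y" using k \<open>q > 0\<close> by (auto simp: B_def pair_def)
        then show ?thesis using \<open>q > 0\<close> by auto
      next
        case False
        define w where "w = (if x < t - k then x - (t - k) + N else x - (t - k))"
        have "w \<in> ?V" "arc N w x = t - k" "arc N w y = t + k + 1"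
          using True k that N by (auto simp: w_def arc_def)
        moreover have "w < 2*t" if "k = t - 1" using that False \<open>x \<in> ?V\<close> \<open>y \<in> ?V\<close> k N
          by (auto simp: w_def)
        ultimately have "A w x y" using True k that by (auto simp: A_def)
        then show ?thesis using \<open>w \<in> ?V\<close> by blast
      qed
    next
      case far: False
      show ?thesis
      proof (cases "k = t")
        case True
        then have "y = x + (2*t + 1)" using k by simp
        then have "B q x y \<or> B 0 x y" using \<open>q > 0\<close> by (auto simp: B_def)
        then show ?thesis using \<open>q > 0\<close> by auto
      next
        case False
        define w where "w = y - (k + 1 - t)"
        have "w \<in> ?V" "arc N w x = 3*t - k" "arc N w y = k + 1 - t"
          using far False k that N by (auto simp: w_def arc_def)
        moreover have "k < 2*t" using k that N by auto
        ultimately have "A w x y" using far False by (auto simp: A_def)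
        then show ?thesis using \<open>w \<in> ?V\<close> by blast
      qed
    qed
  qed
  have arc_last: "arc N (N - 1) 0 = 1" "arc N (N - 1) (N - 2) = N - 1"
    using N t by (simp_all add: arc_def)
  show "y = z" if "x \<in> ?V" "y \<in> ?V" "z \<in> ?V" "A w x y" "A w x z" for w x y z
  proof (cases "w = N - 1")
    case False
    then have "arc N w y = arc N w z" using that by (auto simp: A_def)
    then show ?thesis using that arc_eq by blast
  next
    case True
    have *: "arc N w 0 = 1" "arc N w (N - 2) = N - 1" "\<not> w < 2*t" using arc_last True N t by auto
    show ?thesis
    proof (cases "x = 0 \<or> x = N - 2")
      case True
      then have "pair 0 (N - 2) x y" "pair 0 (N - 2) x z" using that(4,5) * N t by (auto simp: A_def)
      then show ?thesis by (auto simp: pair_def)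
    next
      case False
      then have "arc N w y = arc N w z" using that by (auto simp: A_def pair_def)
      then show ?thesis using that arc_eq by blast
    qed
  qed
  show "y = z" if "s \<in> ?F" "x \<in> ?V" "y \<in> ?V" "z \<in> ?V" "B s x y" "B s x z" for s x y z
  proof -
    consider "s = q" | "s = 0" "s \<noteq> q" | "s \<noteq> 0" "s \<noteq> q" by blast
    then show ?thesis
    proof cases
      case 1
      then have "((x = y + (2*t + 1) \<or> y = x + (2*t + 1)) \<and> \<not> pair (2*t - 3) (N - 2) x y) \<or>
        pair (2*t - 3) (2*t - 1) x y"
        "((x = z + (2*t + 1) \<or> z = x + (2*t + 1)) \<and> \<not> pair (2*t - 3) (N - 2) x z) \<or>
        pair (2*t - 3) (2*t - 1) x z"
        using that by (simp_all add: B_def)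
      then show ?thesis using that(2-4) N t unfolding pair_def atLeastLessThan_iff by smt
    next
      case 2
      show ?thesis
      proof (cases "x \<in> S")
        case False
        then show ?thesis using that 2 drr_unique[of 0 x y z]
          by (auto simp: B_def pair_def S_def)
      next
        case True
        then have "pair (2*t - 3) (N - 2) x y \<or> pair 0 (2*t - 1) x y"
          "pair (2*t - 3) (N - 2) x z \<or> pair 0 (2*t - 1) x z"
          using that 2 by (auto simp: B_def)
        then show ?thesis using N t unfolding pair_def by smt
      qed
    next
      case 3
      then show ?thesis using that drr_unique[of s x y z] by (simp add: B_def)
    qed
  qed
  show "\<not> A w w y" for w y using N t by (auto simp: A_def pair_def split: if_splits)
  show "\<not> A x w z" if "w \<in> ?V" "x \<in> ?V" "A w x y" for w x y z
  proof
    assume "A x w z"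
    have "w \<noteq> x" using that(3) N t by (auto simp: A_def pair_def split: if_splits)
    then have sum: "arc N w x + arc N x w = 4 * t" using arc_swap[of w x N] N by simp
    have out: "arc N u v \<le> 2*t \<and> (arc N u v = 2*t \<longrightarrow> u < 2*t) \<and> arc N u v \<ge> (if u < 2*t then 1 else 2) \<or>
        u = N - 1 \<and> (v = 0 \<or> v = N - 2)" if "A u v y" for u v y
      using that by (auto simp: A_def pair_def split: if_splits)
    have no_return: False if "u = 0 \<or> u = N - 2" "A u (N - 1) v" for u v
      using that(1)
    proof
      assume "u = 0"
      moreover have "arc N 0 (N - 1) = N - 1" using N t by (simp add: arc_def)
      ultimately show False using out[OF that(2)] N t by auto
    next
      assume "u = N - 2"
      moreover have "arc N (N - 2) (N - 1) = 1" by (simp add: arc_def)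
      ultimately show False using out[OF that(2)] N t by (auto split: if_splits)
    qed
    show False
    proof (cases "w = N - 1 \<and> (x = 0 \<or> x = N - 2) \<or> x = N - 1 \<and> (w = 0 \<or> w = N - 2)")
      case True
      then show False using no_return \<open>A w x y\<close> \<open>A x w z\<close> by blast
    next
      case False
      then have "arc N w x = 2*t" "w < 2*t" "x < 2*t"
        using out[OF \<open>A w x y\<close>] out[OF \<open>A x w z\<close>] sum by auto
      then show False using N \<open>w \<in> ?V\<close> \<open>x \<in> ?V\<close> by (auto simp: arc_def split: if_splits)
    qed
  qed
qed

section \<open>Orders congruent to 3 modulo 4\<close>

text \<open>
Order \<open>3\<close> is separate because the construction below degenerates for \<open>m = 0\<close>, where \<open>Inner 0\<close> and
\<open>Outer 0\<close> would reach each other.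
\<close>

lemma harmonious_design_3: "harmonious_design {0..2::int} {0..1::int}
    (\<lambda>w x y. w = 0 \<and> pair 1 2 x y)
    (\<lambda>s x y. pair 0 (s + 1) x y)"
proof (rule harmonious_designI_linorder)
  fix x y :: int assume "x \<in> {0..2}" "y \<in> {0..2}" "x < y"
  then consider "x = 0" | "x = 1" "y = 2" by fastforce
  then show "(\<exists>w\<in>{0..2::int}. w = 0 \<and> pair 1 2 x y) \<or> (\<exists>s\<in>{0..1}. pair 0 (s + 1) x y)"
  proof cases
    case 1
    then show ?thesis using \<open>x < y\<close> \<open>y \<in> {0..2}\<close>
      by (intro disjI2 bexI[of _ "y - 1"]) (auto simp: pair_def)
  qed (auto simp: pair_def)
qed (auto simp: pair_def)

text \<open>
The vertices for orders congruent to \<open>3\<close> modulo \<open>4\<close>: two copies of the integers modulo \<open>p = 2 * m + 1\<close> and one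
additional vertex.
\<close>

datatype two_rings = Inner int | Outer int | Centre

text \<open>
Each edge is listed in one of its two orientations. With indices modulo \<open>p\<close>, \<open>Inner w\<close> colours the edges
\<open>{Centre, Outer w}\<close> and \<open>{Inner (w + i), Outer (w - i)}\<close> for \<open>1 \<le> i \<le> m\<close>, and \<open>Outer w\<close> colours
\<open>{Centre, Inner (w - m)}\<close> and \<open>{Outer (w + i), Inner (w - i)}\<close> for \<open>1 \<le> i \<le> m - 1\<close>.
\<close>

fun half_vertex_coloured :: "int \<Rightarrow> two_rings \<Rightarrow> two_rings \<Rightarrow> two_rings \<Rightarrow> bool" where
  "half_vertex_coloured m (Inner w) Centre (Outer y) \<longleftrightarrow> y = w"
| "half_vertex_coloured m (Inner w) (Inner x) (Outer y) \<longleftrightarrow>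
     arc (2*m+1) w x = arc (2*m+1) y w \<and> arc (2*m+1) w x \<in> {1..m}"
| "half_vertex_coloured m (Outer w) Centre (Inner y) \<longleftrightarrow> arc (2*m+1) y w = m"
| "half_vertex_coloured m (Outer w) (Outer x) (Inner y) \<longleftrightarrow>
     arc (2*m+1) w x = arc (2*m+1) y w \<and> arc (2*m+1) w x \<in> {1..m-1}"
| "half_vertex_coloured m _ _ _ \<longleftrightarrow> False"

text \<open>
Two copies of \<open>K\<^sub>p\<close> coloured by the sum of the indices, with the edges \<open>{Inner x, Outer x}\<close> in the colour
\<open>2 * x\<close> that both ends miss; the additional colour \<open>p\<close> is for the perfect matching
\<open>{Inner (x + 1), Outer x}\<close>.
\<close>

fun half_fresh_coloured :: "int \<Rightarrow> int \<Rightarrow> two_rings \<Rightarrow> two_rings \<Rightarrow> bool" where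
  "half_fresh_coloured p s (Inner x) (Inner y) \<longleftrightarrow> s \<noteq> p \<and> x \<noteq> y \<and> (x + y = s \<or> x + y = s + p)"
| "half_fresh_coloured p s (Outer x) (Outer y) \<longleftrightarrow> s \<noteq> p \<and> x \<noteq> y \<and> (x + y = s \<or> x + y = s + p)"
| "half_fresh_coloured p s (Inner x) (Outer y) \<longleftrightarrow>
     (if s = p then arc p y x = 1 else x = y \<and> (2 * x = s \<or> 2 * x = s + p))"
| "half_fresh_coloured p s _ _ \<longleftrightarrow> False"

text \<open>
A superset of the pairs \<open>(w, x)\<close> such that \<open>w\<close> colours an edge at \<open>x\<close>; that it is asymmetric is visible from
the lengths of the arcs.
\<close>

fun reaches :: "int \<Rightarrow> two_rings \<Rightarrow> two_rings \<Rightarrow> bool" where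
  "reaches m (Inner w) (Inner x) \<longleftrightarrow> arc (2*m+1) w x \<in> {1..m}"
| "reaches m (Inner w) (Outer x) \<longleftrightarrow> arc (2*m+1) x w \<le> m"
| "reaches m (Outer w) (Outer x) \<longleftrightarrow> arc (2*m+1) w x \<in> {1..m-1}"
| "reaches m (Outer w) (Inner x) \<longleftrightarrow> arc (2*m+1) x w \<in> {1..m}"
| "reaches m Centre x \<longleftrightarrow> False"
| "reaches m w Centre \<longleftrightarrow> True"

text \<open>
An edge \<open>{Inner x, Outer y}\<close> is classified by \<open>x - y\<close> modulo \<open>p\<close>: positive even values \<open>2 * i\<close> belong to the vertices
\<open>Inner w\<close>, odd values \<open>p - 2 * i\<close> other than \<open>1\<close> to the vertices \<open>Outer w\<close>, and the values \<open>0\<close> and \<open>1\<close> are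
left to the fresh colours. Edges within a ring are all fresh, edges at \<open>Centre\<close> are never fresh.
\<close>

lemma harmonious_design_3_mod_4:
  fixes m p :: int
  assumes m: "m \<ge> 1" and p: "p = 2 * m + 1"
  shows "harmonious_design (Inner ` {0..<p} \<union> Outer ` {0..<p} \<union> {Centre}) {0..p}
    (\<lambda>w x y. half_vertex_coloured m w x y \<or> half_vertex_coloured m w y x)
    (\<lambda>s x y. half_fresh_coloured p s x y \<or> half_fresh_coloured p s y x)"
    (is "harmonious_design ?V ?F ?A ?B")
proof -
  have reaches: "reaches m w x" if "?A w x y" for w x y
    using that m by (cases w; cases x; cases y) auto
  have irrefl: "\<not> reaches m w w" for w by (cases w) auto
  have antisym: "\<not> (reaches m w x \<and> reaches m x w)" for w x
  proof -
    have sum: "arc p u v + arc p v u = p" if "u \<noteq> v" for u v using that by (rule arc_swap)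
    show ?thesis
    proof (cases w; cases x)
      fix u v assume uv: "w = Inner u" "x = Inner v"
      then show ?thesis using sum[of u v] p by (cases "u = v") auto
    next
      fix u v assume uv: "w = Outer u" "x = Outer v"
      then show ?thesis using sum[of u v] p by (cases "u = v") auto
    next
      fix u v assume uv: "w = Inner u" "x = Outer v"
      then show ?thesis using sum[of u v] p by (cases "u = v") auto
    next
      fix u v assume uv: "w = Outer u" "x = Inner v"
      then show ?thesis using sum[of u v] p by (cases "u = v") auto
    qed auto
  qed
  have cover_Inner: "\<exists>s\<in>?F. s \<noteq> p \<and> (x + y = s \<or> x + y = s + p)" if "x \<in> {0..<p}" "y \<in> {0..<p}" for x y
    by (rule bexI[of _ "if x + y < p then x + y else x + y - p"]) (use that in auto)
  have cover_cross: "(\<exists>w\<in>?V. ?A w (Inner x) (Outer y)) \<or> (\<exists>s\<in>?F. ?B s (Inner x) (Outer y))"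
    if xy: "x \<in> {0..<p}" "y \<in> {0..<p}" for x y
  proof -
    define d where "d = arc p y x"
    have d: "d \<in> {0..<p}" using xy by (auto simp: d_def arc_def)
    consider "d = 0" | "d = 1" | "even d" "d > 0" | "odd d" "d \<ge> 3"
    proof -
      have "d = 0 \<or> d = 1 \<or> even d \<and> d > 0 \<or> odd d \<and> d \<ge> 3" using d by (cases "d \<le> 2") (auto, presburger)
      then show ?thesis using that by blast
    qed
    then show ?thesis
    proof cases
      case 1
      then have "x = y" using xy by (auto simp: d_def arc_def split: if_splits)
      moreover obtain s where "s \<in> ?F" "s \<noteq> p" "x + x = s \<or> x + x = s + p"
        using cover_Inner xy by blast
      ultimately have "?B s (Inner x) (Outer y)" by simp
      then show ?thesis using \<open>s \<in> ?F\<close> by blast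
    next
      case 2
      then have "?B p (Inner x) (Outer y)" by (simp add: d_def)
      then show ?thesis using m p by auto
    next
      case 3
      then obtain i where i: "d = 2 * i" by (elim evenE)
      define w where "w = (if y + i < p then y + i else y + i - p)"
      have "w \<in> {0..<p}" "arc p w x = i" "arc p y w = i" "i \<in> {1..m}"
        using 3 i d xy p by (auto simp: w_def d_def arc_def split: if_splits)
      then have "?A (Inner w) (Inner x) (Outer y)" "Inner w \<in> ?V" by (auto simp: p)
      then show ?thesis by blast
    next
      case 4
      then obtain j where j: "d = 2 * j + 1" by (elim oddE)
      define i where "i = m - j"
      define w where "w = (if x + i < p then x + i else x + i - p)"
      have "w \<in> {0..<p}" "arc p w y = i" "arc p x w = i" "i \<in> {1..m-1}"
        using 4 j d xy p by (auto simp: w_def i_def d_def arc_def split: if_splits)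
      then have "?A (Outer w) (Inner x) (Outer y)" "Outer w \<in> ?V" by (auto simp: p)
      then show ?thesis by blast
    qed
  qed
  have cover_Centre: "\<exists>w\<in>?V. ?A w x Centre" if "x \<in> ?V" "x \<noteq> Centre" for x
  proof (cases x)
    case (Inner y)
    define w where "w = (if y + m < p then y + m else y + m - p)"
    have "w \<in> {0..<p}" "arc p y w = m" using Inner that m p by (auto simp: w_def arc_def)
    then have "?A (Outer w) x Centre" "Outer w \<in> ?V" using Inner by (auto simp: p)
    then show ?thesis by blast
  next
    case (Outer y)
    then have "?A (Inner y) x Centre" "Inner y \<in> ?V" using that by auto
    then show ?thesis by blast
  qed (use that in simp)
  define R where "R = {0..<p}"
  have mem: "Inner u \<in> ?V \<longleftrightarrow> u \<in> R" "Outer u \<in> ?V \<longleftrightarrow> u \<in> R" for u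
    by (auto simp: R_def)
  have arc_eq: "u = v" if "arc p w u = arc p w v" "u \<in> R" "v \<in> R" for u v w
    using that unfolding R_def by (rule arc_right_inject)
  have arc_eq': "u = v" if "arc p u w = arc p v w" "u \<in> R" "v \<in> R" for u v w
    using that unfolding R_def by (rule arc_left_inject)
  have matching_A: "y = z" if "w \<in> ?V" "x \<in> ?V" "y \<in> ?V" "z \<in> ?V" "?A w x y" "?A w x z" for w x y z
  proof -
    note hyps = that
    show ?thesis
    proof (cases w)
      case w: (Inner u)
      show ?thesis
      proof (cases x)
        case x: (Inner v)
        then obtain a b where ab: "y = Outer a" "z = Outer b"
          using hyps(5,6) w by (cases y; cases z) auto
        then have "arc p a u = arc p b u" using hyps(5,6) w x p by simp
        then show ?thesis using ab hyps(3,4) mem arc_eq' by blast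
      next
        case x: (Outer v)
        consider "y = Centre" "z = Centre" | a where "y = Centre" "z = Inner a"
          | a where "y = Inner a" "z = Centre" | a b where "y = Inner a" "z = Inner b"
          using hyps(5,6) w x by (cases y; cases z) auto
        then show ?thesis
        proof cases
          case 4
          then have "arc p u a = arc p u b" using hyps(5,6) w x p by simp
          then show ?thesis using 4 hyps(3,4) mem arc_eq by blast
        qed (use hyps(5,6) w x in auto)
      next
        case Centre
        then show ?thesis using hyps(5,6) w by (cases y; cases z) auto
      qed
    next
      case w: (Outer u)
      show ?thesis
      proof (cases x)
        case x: (Outer v)
        then obtain a b where ab: "y = Inner a" "z = Inner b"
          using hyps(5,6) w by (cases y; cases z) auto
        then have "arc p a u = arc p b u" using hyps(5,6) w x p by simp
        then show ?thesis using ab hyps(3,4) mem arc_eq' by blast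
      next
        case x: (Inner v)
        consider "y = Centre" "z = Centre" | a where "y = Centre" "z = Outer a"
          | a where "y = Outer a" "z = Centre" | a b where "y = Outer a" "z = Outer b"
          using hyps(5,6) w x by (cases y; cases z) auto
        then show ?thesis
        proof cases
          case 4
          then have "arc p u a = arc p u b" using hyps(5,6) w x p by simp
          then show ?thesis using 4 hyps(3,4) mem arc_eq by blast
        qed (use hyps(5,6) w x in auto)
      next
        case Centre
        then obtain a b where ab: "y = Inner a" "z = Inner b"
          using hyps(5,6) w by (cases y; cases z) auto
        then have "arc p a u = arc p b u" using hyps(5,6) w Centre p by simp
        then show ?thesis using ab hyps(3,4) mem arc_eq' by blast
      qed
    qed (use that in simp)
  qed
  have matching_B: "y = z" if "s \<in> ?F" "x \<in> ?V" "y \<in> ?V" "z \<in> ?V" "?B s x y" "?B s x z" for s x y z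
  proof (cases "s = p")
    case True
    have "(\<exists>a b. y = Outer a \<and> z = Outer b \<and> (\<exists>u. arc p a u = arc p b u)) \<or>
          (\<exists>a b. y = Inner a \<and> z = Inner b \<and> (\<exists>u. arc p u a = arc p u b))"
      using that(5,6) True by (cases x; cases y; cases z) (simp_all, metis+)
    then show ?thesis using that(3,4) mem arc_eq arc_eq' by blast
  next
    case False
    then show ?thesis using that by (cases x; cases y; cases z) auto
  qed
  show ?thesis unfolding harmonious_design_def
  proof (intro conjI ballI impI)
    fix x y assume xy: "x \<in> ?V" "y \<in> ?V" "x \<noteq> y"
    show "(\<exists>w\<in>?V. ?A w x y) \<or> (\<exists>s\<in>?F. ?B s x y)"
    proof (cases "x = Centre \<or> y = Centre")
      case True
      then show ?thesis using cover_Centre[of x] cover_Centre[of y] xy by metis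
    next
      case False
      then consider u v where "x = Inner u" "y = Inner v" | u v where "x = Outer u" "y = Outer v"
        | u v where "x = Inner u" "y = Outer v" | u v where "x = Outer u" "y = Inner v"
        by (metis two_rings.exhaust)
      then show ?thesis
      proof cases
        case 1
        with xy cover_Inner[of u v] show ?thesis by auto
      next
        case 2
        with xy cover_Inner[of u v] show ?thesis by auto
      next
        case 3
        with xy mem have "u \<in> {0..<p}" "v \<in> {0..<p}" by (simp_all add: R_def)
        from cover_cross[OF this] 3 show ?thesis by blast
      next
        case 4
        with xy mem have "v \<in> {0..<p}" "u \<in> {0..<p}" by (simp_all add: R_def)
        from cover_cross[OF this] 4 show ?thesis by blast
      qed
    qed
  next
    fix w x y z assume hyps: "w \<in> ?V" "x \<in> ?V" "y \<in> ?V" "z \<in> ?V" "?A w x y \<and> ?A w x z"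
    show "y = z" using hyps(1-4) hyps(5)[THEN conjunct1] hyps(5)[THEN conjunct2] by (rule matching_A)
  next
    fix s x y z assume hyps: "s \<in> ?F" "x \<in> ?V" "y \<in> ?V" "z \<in> ?V" "?B s x y \<and> ?B s x z"
    show "y = z" using hyps(1-4) hyps(5)[THEN conjunct1] hyps(5)[THEN conjunct2] by (rule matching_B)
  next
    fix w y
    show "\<not> ?A w w y" using reaches[of w w y] irrefl by blast
  next
    fix w x y z assume "?A w x y"
    then show "\<not> ?A x w z" using reaches[of w x y] reaches[of x w z] antisym by blast
  next
    fix w x y assume "?A w x y"
    then show "?A w y x" by (rule disj_commute[THEN iffD1])
  next
    fix s x y assume "?B s x y"
    then show "?B s y x" by (rule disj_commute[THEN iffD1])
  qed
qed

lemma ex_harmonious_design: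
  assumes "finite V" "card V = n" "n \<ge> 2" "n \<noteq> 4"
  shows "\<exists>F :: int set. \<exists>A B. finite F \<and> card F = (n + 1) div 2 \<and> harmonious_design V F A B"
proof -
  note via = harmonious_design_of_card[OF assms(1,2)]
  have "n = 3 \<or> n mod 4 = 0 \<or> n mod 4 = 1 \<or> n mod 4 = 2 \<or> n \<noteq> 3 \<and> n mod 4 = 3" by presburger
  then consider "n = 3" | "n mod 4 = 0" | "n mod 4 = 1" | "n mod 4 = 2" | "n \<noteq> 3" "n mod 4 = 3" by metis
  then show ?thesis
  proof cases
    case 1
    show ?thesis by (rule via[OF harmonious_design_3]) (simp_all add: 1)
  next
    case 2
    define t where "t = n div 4"
    have t: "n = 4 * t" "t \<ge> 2" using 2 assms by (auto simp: t_def)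
    show ?thesis
      by (rule via[OF harmonious_design_0_mod_4[of "int t" _ "2 * int t - 1"]])
        (use t in \<open>auto simp: nat_mult_distrib\<close>)
  next
    case 3
    define t where "t = n div 4"
    have t: "n = 4 * t + 1" using 3 div_mult_mod_eq[of n 4] by (simp add: t_def)
    then have "t \<ge> 1" using assms by linarith
    show ?thesis
      by (rule via[OF harmonious_design_1_mod_4[of "int t"]])
        (use t \<open>t \<ge> 1\<close> in \<open>auto simp: nat_mult_distrib nat_add_distrib\<close>)
  next
    case 4
    define t where "t = n div 4"
    have t: "n = 4 * t + 2" using 4 div_mult_mod_eq[of n 4] by (simp add: t_def)
    show ?thesis
      by (rule via[OF harmonious_design_2_mod_4[of "int t"]])
        (use t in \<open>auto simp: nat_mult_distrib nat_add_distrib\<close>)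
  next
    case 5
    define m where "m = n div 4"
    have m: "n = 4 * m + 3" using 5 div_mult_mod_eq[of n 4] by (simp add: m_def)
    then have "m \<ge> 1" using 5 by linarith
    let ?R = "{0..<2 * int m + 1}"
    have "card (Inner ` ?R \<union> Outer ` ?R \<union> {Centre}) = card (Inner ` ?R \<union> Outer ` ?R) + 1"
      by (subst card_Un_disjoint) auto
    also have "card (Inner ` ?R \<union> Outer ` ?R) = card (Inner ` ?R) + card (Outer ` ?R)"
      by (subst card_Un_disjoint) auto
    also have "card (Inner ` ?R) = 2 * m + 1" by (simp add: card_image inj_on_def nat_add_distrib nat_mult_distrib)
    also have "card (Outer ` ?R) = 2 * m + 1" by (simp add: card_image inj_on_def nat_add_distrib nat_mult_distrib)
    finally have "card (Inner ` ?R \<union> Outer ` ?R \<union> {Centre}) = n" using m by simp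
    then show ?thesis
      by (intro via[OF harmonious_design_3_mod_4[of "int m" "2 * int m + 1"]])
        (use m \<open>m \<ge> 1\<close> in \<open>auto simp: nat_mult_distrib nat_add_distrib\<close>)
  qed
qed

section \<open>From designs to total colourings\<close>

text \<open>
Number the edges in each parallel class by \<open>0, \<dots>, l - 1\<close>. The edges numbered \<open>0\<close> form a complete graph that is coloured by
the harmonious design; the edges numbered \<open>i > 0\<close> are coloured properly with a set of colours of their own,
\<open>{i} \<times> S\<close>. A repeated pair of colours would, in a proper total colouring, consist of the colours of two vertices, so
harmony only concerns the edges numbered \<open>0\<close>.
\<close>

lemma harmonious_total_chromatic_number_le:
  fixes G :: "('v, 'e) multigraph" and F :: "'f set" and S :: "'s set"
  assumes G: "complete_multigraph l n G" and "l \<ge> 1"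
    and D: "harmonious_design (verts G) F A B" "finite F"
    and D': "harmonious_design (verts G) S (\<lambda>_ _ _. False) Q" "finite S"
  shows "harmonious_total_chromatic_number G \<le> n + card F + (l - 1) * card S"
proof -
  let ?V = "verts G" and ?E = "edges G"
  have fin: "finite ?V" "finite ?E" and n: "card ?V = n"
    and ends: "\<And>e. e \<in> ?E \<Longrightarrow> ends G e \<subseteq> ?V \<and> card (ends G e) = 2"
    and par: "\<And>u v. u \<in> ?V \<Longrightarrow> v \<in> ?V \<Longrightarrow> u \<noteq> v \<Longrightarrow> card {e \<in> ?E. ends G e = {u, v}} = l"
    using G by (auto simp: complete_multigraph_def is_multigraph_def)
  have ends_eq: "\<exists>x y. ends G e = {x, y} \<and> x \<noteq> y \<and> x \<in> ?V \<and> y \<in> ?V" if "e \<in> ?E" for e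
    using ends[OF that] unfolding card_2_iff by blast
  have other_end: "\<exists>x. ends G e = {v, x} \<and> v \<noteq> x \<and> x \<in> ?V \<and> v \<in> ?V" if "e \<in> ?E" "v \<in> ends G e" for e v
    using ends_eq[OF that(1)] that(2) by (auto simp: insert_commute)
  \<comment> \<open>Colours from \<open>V <+> F\<close>: the left summand holds the colours of the vertices.\<close>
  define R where "R k x y = (case k of Inl w \<Rightarrow> A w x y | Inr s \<Rightarrow> B s x y)" for k x y
  have "\<exists>k\<in>?V <+> F. \<forall>x y. ends G e = {x, y} \<longrightarrow> R k x y" if "e \<in> ?E" for e
  proof -
    obtain x y where xy: "ends G e = {x, y}" "x \<noteq> y" "x \<in> ?V" "y \<in> ?V" using ends_eq[OF \<open>e \<in> ?E\<close>] by blast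
    then have "(\<exists>w\<in>?V. A w x y) \<or> (\<exists>s\<in>F. B s x y)" using harmonious_design_cover[OF D(1)] by blast
    then obtain k where k: "k \<in> ?V <+> F" "R k x y" unfolding R_def by (metis InlI InrI sum.case)
    moreover have "R k y x"
      using k harmonious_design_sym_vertex[OF D(1)] harmonious_design_sym_fresh[OF D(1)] xy(3,4)
      unfolding R_def by (elim PlusE) simp_all
    ultimately show ?thesis using xy by (auto simp: doubleton_eq_iff intro!: bexI[of _ k])
  qed
  then obtain base where base: "\<And>e. e \<in> ?E \<Longrightarrow> base e \<in> ?V <+> F"
    "\<And>e x y. e \<in> ?E \<Longrightarrow> ends G e = {x, y} \<Longrightarrow> R (base e) x y"
    by metis
  have "\<exists>k\<in>S. \<forall>x y. ends G e = {x, y} \<longrightarrow> Q k x y" if "e \<in> ?E" for e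
  proof -
    obtain x y where xy: "ends G e = {x, y}" "x \<noteq> y" "x \<in> ?V" "y \<in> ?V" using ends_eq[OF \<open>e \<in> ?E\<close>] by blast
    then obtain k where k: "k \<in> S" "Q k x y"
      using harmonious_design_cover[OF D'(1) xy(3,4,2)] by blast
    moreover have "Q k y x" using harmonious_design_sym_fresh[OF D'(1) k(1) xy(3,4) k(2)] .
    ultimately show ?thesis using xy by (auto simp: doubleton_eq_iff intro!: bexI[of _ k])
  qed
  then obtain copy where copy: "\<And>e. e \<in> ?E \<Longrightarrow> copy e \<in> S"
    "\<And>e x y. e \<in> ?E \<Longrightarrow> ends G e = {x, y} \<Longrightarrow> Q (copy e) x y"
    by metis
  have "\<exists>h. bij_betw h {e\<in>?E. ends G e = s} {0..<card {e\<in>?E. ends G e = s}}" for s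
    using fin by (intro ex_bij_betw_finite_nat) simp
  then obtain h where h: "\<And>s. bij_betw (h s) {e\<in>?E. ends G e = s} {0..<card {e\<in>?E. ends G e = s}}"
    by metis
  define idx where "idx e = h (ends G e) e" for e
  have idx_less: "idx e < l" if "e \<in> ?E" for e
  proof -
    obtain x y where "ends G e = {x, y}" "x \<noteq> y" "x \<in> ?V" "y \<in> ?V" using ends_eq[OF \<open>e \<in> ?E\<close>] by blast
    then show ?thesis using bij_betwE[OF h[of "ends G e"]] par[of x y] \<open>e \<in> ?E\<close> by (auto simp: idx_def)
  qed
  have idx_inj: "e = f" if "e \<in> ?E" "f \<in> ?E" "ends G e = ends G f" "idx e = idx f" for e f
    using bij_betw_imp_inj_on[OF h[of "ends G e"]] that by (auto simp: idx_def inj_on_def)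
  define col :: "'v + 'e \<Rightarrow> ('v + 'f) + (nat \<times> 's)" where
    "col z = (case z of Inl v \<Rightarrow> Inl (Inl v)
       | Inr e \<Rightarrow> if idx e = 0 then Inl (base e) else Inr (idx e, copy e))" for z
  define K where "K = (?V <+> F) <+> ({1..<l} \<times> S)"
  have "finite K" using fin D D' by (simp add: K_def)
  have card_K: "card K = n + card F + (l - 1) * card S"
    using fin D D' n by (simp add: K_def card_Plus card_cartesian_product)
  have col_K: "col z \<in> K" if "z \<in> ?V <+> ?E" for z
    using that base(1) copy(1) idx_less by (auto simp: K_def col_def)
  obtain g :: "('v + 'f) + (nat \<times> 's) \<Rightarrow> nat" where g: "inj_on g K"
    using finite_imp_inj_to_nat_seg[OF \<open>finite K\<close>] by blast
  define c where "c = g \<circ> col"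
  have c_eq: "c z = c z' \<longleftrightarrow> col z = col z'" if "z \<in> ?V <+> ?E" "z' \<in> ?V <+> ?E" for z z'
    using inj_on_eq_iff[OF g col_K col_K] that by (simp add: c_def)
  have edge_col: "col (Inr e) \<noteq> col (Inr f)"
    if e: "e \<in> ?E" "v \<in> ends G e" and f: "f \<in> ?E" "v \<in> ends G f" and "e \<noteq> f" for e f v
  proof
    assume eq: "col (Inr e) = col (Inr f)"
    obtain x where x: "ends G e = {v, x}" "x \<in> ?V" "v \<in> ?V" using other_end[OF e] by blast
    obtain y where y: "ends G f = {v, y}" "y \<in> ?V" using other_end[OF f] by blast
    have same_idx: "idx e = idx f" using eq by (auto simp: col_def split: if_splits)
    have "x = y"
    proof (cases "idx e = 0")
      case True
      then have "base f = base e" using eq same_idx by (simp add: col_def)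
      then have "R (base e) v x" "R (base e) v y" "base e \<in> ?V <+> F"
        using base e(1) f(1) x y by metis+
      then show ?thesis
        using harmonious_design_matching_vertex[OF D(1) _ x(3,2) y(2)]
          harmonious_design_matching_fresh[OF D(1) _ x(3,2) y(2)]
        unfolding R_def by (elim PlusE) simp_all
    next
      case False
      then have "copy f = copy e" using eq same_idx by (simp add: col_def)
      then have "Q (copy e) v x" "Q (copy e) v y" "copy e \<in> S"
        using copy e(1) f(1) x y by metis+
      then show ?thesis
        using harmonious_design_matching_fresh[OF D'(1) _ x(3,2) y(2)] by blast
    qed
    then show False using idx_inj[OF e(1) f(1)] same_idx x y \<open>e \<noteq> f\<close> by simp
  qed
  have vertex_edge_col: "\<exists>x\<in>?V. A w v x" if e: "e \<in> ?E" "v \<in> ends G e" and eq: "col (Inl w) = col (Inr e)" for w v e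
  proof -
    obtain x where x: "ends G e = {v, x}" "x \<in> ?V" using other_end[OF e] by blast
    have "base e = Inl w" using eq by (auto simp: col_def split: if_splits)
    then show ?thesis using base(2)[OF e(1) x(1)] x(2) by (auto simp: R_def)
  qed
  have no_self: "\<not> A v v x" if "v \<in> ?V" "x \<in> ?V" for v x
    using harmonious_design_irrefl[OF D(1) that] .
  have no_swap: "\<not> A v w y" if "v \<in> ?V" "w \<in> ?V" "x \<in> ?V" "y \<in> ?V" "A w v x" for v w x y
    using harmonious_design_asym[OF D(1) that(2,1,3,4,5)] .
  have total: "total_colouring G c"
    unfolding total_colouring_def
  proof (intro conjI allI impI ballI)
    fix u v assume uv: "adjacent_vertices G u v"
    then have "u \<in> ?V" "v \<in> ?V" using ends by (auto simp: adjacent_vertices_def)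
    then show "c (Inl u) \<noteq> c (Inl v)"
      using uv c_eq[of "Inl u" "Inl v"] by (simp add: InlI col_def adjacent_vertices_def)
  next
    fix e f assume "adjacent_edges G e f"
    then obtain v where "e \<in> ?E" "f \<in> ?E" "e \<noteq> f" "v \<in> ends G e" "v \<in> ends G f"
      by (auto simp: adjacent_edges_def)
    then show "c (Inr e) \<noteq> c (Inr f)"
      using edge_col c_eq[of "Inr e" "Inr f"] by (simp add: InrI)
  next
    fix p assume "p \<in> incident_pairs G"
    then obtain v e where p: "p = (v, e)" and ve: "v \<in> ?V" "e \<in> ?E" "v \<in> ends G e"
      by (auto simp: incident_pairs_def)
    have "col (Inl v) \<noteq> col (Inr e)" using vertex_edge_col[OF ve(2,3)] no_self ve(1) by blast
    then show "case p of (v, e) \<Rightarrow> c (Inl v) \<noteq> c (Inr e)"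
      using c_eq[of "Inl v" "Inr e"] p ve by (simp add: InlI InrI)
  qed
  have harmonious: "{c (Inl v), c (Inr e)} \<noteq> {c (Inl w), c (Inr f)}"
    if "(v, e) \<in> incident_pairs G" "(w, f) \<in> incident_pairs G" and neq: "(v, e) \<noteq> (w, f)" for v e w f
  proof
    have ve: "v \<in> ?V" "e \<in> ?E" "v \<in> ends G e" and wf: "w \<in> ?V" "f \<in> ?E" "w \<in> ends G f"
      using that by (auto simp: incident_pairs_def)
    assume "{c (Inl v), c (Inr e)} = {c (Inl w), c (Inr f)}"
    then consider "c (Inl v) = c (Inl w)" "c (Inr e) = c (Inr f)"
      | "c (Inl v) = c (Inr f)" "c (Inr e) = c (Inl w)"
      by (auto simp: doubleton_eq_iff)
    then show False
    proof cases
      case 1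
      then have "v = w" "col (Inr e) = col (Inr f)"
        using c_eq ve wf by (auto simp: InlI InrI col_def)
      then show False using edge_col[OF ve(2,3) wf(2)] wf(3) neq by blast
    next
      case 2
      then have "col (Inl v) = col (Inr f)" "col (Inl w) = col (Inr e)"
        using c_eq[of "Inl v" "Inr f"] c_eq[of "Inr e" "Inl w"] ve wf by (simp_all add: InlI InrI)
      then show False using vertex_edge_col[OF ve(2,3)] vertex_edge_col[OF wf(2,3)] no_swap ve(1) wf(1)
        by blast
    qed
  qed
  have "harmonious_total_colouring G c"
    unfolding harmonious_total_colouring_def
  proof (intro conjI total ballI)
    fix p assume p: "p \<in> incident_pairs G"
    obtain v e where "p = (v, e)" by (cases p)
    then show "case p of (v, e) \<Rightarrow> \<forall>(w, f)\<in>incident_pairs G. (v, e) \<noteq> (w, f) \<longrightarrow>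
        {c (Inl v), c (Inr e)} \<noteq> {c (Inl w), c (Inr f)}"
      using harmonious p by blast
  qed
  then have "harmonious_total_chromatic_number G \<le> card (c ` (?V <+> ?E))"
    unfolding harmonious_total_chromatic_number_def by (intro Least_le) blast
  also have "\<dots> \<le> card (g ` K)"
    using col_K \<open>finite K\<close> by (intro card_mono) (auto simp: c_def)
  also have "\<dots> = n + card F + (l - 1) * card S" using g card_K by (simp add: card_image)
  finally show ?thesis .
qed

section \<open>The harmonious total chromatic number\<close>

lemma harmonious_total_chromatic_number_attained:
  assumes "is_multigraph (G :: ('v, 'e) multigraph)"
  obtains c :: "'v + 'e \<Rightarrow> nat"
  where "harmonious_total_colouring G c"
    "harmonious_total_chromatic_number G = card (c ` (verts G <+> edges G))"
proof -
  have "\<exists>k. \<exists>c :: 'v + 'e \<Rightarrow> nat. harmonious_total_colouring G c \<and> card (c ` (verts G <+> edges G)) = k"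
    using harmonious_total_colouring_exists[OF assms] by blast
  from LeastI_ex[OF this] show ?thesis
    using that unfolding harmonious_total_chromatic_number_def by metis
qed

text \<open>
The bound \<open>degree_bound\<close> divided by \<open>2 * n\<close> or \<open>2 * (n - 1)\<close> and rounded up to the next integer. On the
left the factor of \<open>l\<close> is \<open>n - 1\<close> for even \<open>n\<close> and \<open>n\<close> for odd \<open>n\<close>.
\<close>

lemma fresh_colours_bound:
  fixes n d f :: nat
  assumes "n \<ge> 2" "2 * (n * ((n - 1) * l)) \<le> 4 * (n div 2) * f + n * (n - 1)"
  shows "(2 * ((n + 1) div 2) - 1) * l \<le> f + (n div 2) - (if even n then 1 else 0)"
proof (cases "even n")
  case True
  then obtain a where a: "n = 2 * a" by (elim evenE)
  with assms have "a > 0" by simp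
  have "2 * a * (2 * ((2 * a - 1) * l)) \<le> 2 * a * (2 * f + (2 * a - 1))"
    using assms(2) by (simp add: a algebra_simps)
  then have "2 * ((2 * a - 1) * l) \<le> 2 * f + (2 * a - 1)" using \<open>a > 0\<close> by (simp add: mult.commute)
  then have "(2 * a - 1) * l \<le> f + a - 1" using \<open>a > 0\<close> by linarith
  then show ?thesis using a by simp
next
  case False
  then obtain a where a: "n = 2 * a + 1" by (elim oddE)
  with assms have "a > 0" by simp
  have "2 * a * (2 * (n * l)) \<le> 2 * a * (2 * f + n)"
    using assms(2) by (simp add: a algebra_simps)
  then have "2 * (n * l) \<le> 2 * f + n" using \<open>a > 0\<close> by simp
  then have "n * l \<le> f + a" using a by linarith
  then show ?thesis using a by simp
qed

theorem theorem4:
  fixes l n :: nat and G :: "('v, 'e) multigraph"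
  assumes "l \<ge> 1" and "n \<ge> 2" and "complete_multigraph l n G"
  shows "(n \<noteq> 4 \<longrightarrow>
           int (harmonious_total_chromatic_number G) =
             (int l - 1) * (2 * \<lceil>real n / 2\<rceil> - 1) + \<lceil>3 * real n / 2\<rceil>) \<and>
         (n = 4 \<longrightarrow> harmonious_total_chromatic_number G = 3 * l + 4)"
proof -
  let ?h = "harmonious_total_chromatic_number G" and ?q = "2 * ((n + 1) div 2) - 1"
  have G: "is_multigraph G" "finite (verts G)" "card (verts G) = n"
    using assms(3) by (auto simp: complete_multigraph_def is_multigraph_def)
  obtain c :: "'v + 'e \<Rightarrow> nat" where c: "harmonious_total_colouring G c"
    "?h = card (c ` (verts G <+> edges G))"
    using harmonious_total_chromatic_number_attained[OF G(1)] .
  define F where "F = c ` (verts G <+> edges G) - c ` Inl ` verts G"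
  have h: "?h = n + card F"
    using colour_incidence_of_colouring(1)[OF assms(3,1) c(1)] c(2) by (simp add: F_def)
  note incidence = colour_incidence_of_colouring(2)[OF assms(3,1) c(1), folded F_def]
  have lower: "?q * l \<le> card F + n div 2 - (if even n then 1 else 0)"
    using fresh_colours_bound[OF assms(2)] colour_incidence.degree_bound[OF incidence] G(3) by simp
  obtain S :: "int set" and Q where S: "finite S" "card S = ?q"
    "harmonious_design (verts G) S (\<lambda>_ _ _. False) Q"
    using ex_one_factorisation[OF G(2)] G(3) assms(2) by auto
  have upper: "?h \<le> n + card F' + (l - 1) * ?q"
    if "harmonious_design (verts G) F' A B" "finite F'" for F' :: "int set" and A B
    using harmonious_total_chromatic_number_le[OF assms(3,1) that S(3,1)] S(2) by simp
  have "n = 4 \<longrightarrow> ?h = 3 * l + 4"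
  proof
    assume n: "n = 4"
    have "3 * l \<le> card F"
      using colour_incidence.four_vertices_bound[OF incidence] n G(3) by simp
    moreover have "?h \<le> 4 + 3 + (l - 1) * 3" using upper[OF S(3,1)] S(2) n by simp
    ultimately show "?h = 3 * l + 4" using h n assms(1) by linarith
  qed
  moreover have "int ?h = (int l - 1) * (2 * \<lceil>real n / 2\<rceil> - 1) + \<lceil>3 * real n / 2\<rceil>" if "n \<noteq> 4"
  proof -
    obtain F' :: "int set" and A B where "finite F'" "card F' = (n + 1) div 2"
      "harmonious_design (verts G) F' A B"
      using ex_harmonious_design[OF G(2,3) assms(2) \<open>n \<noteq> 4\<close>] by blast
    then have le: "?h \<le> n + (n + 1) div 2 + (l - 1) * ?q" using upper by metis
    define copies where "copies = (l - 1) * ?q"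
    have "k * l = k + (l - 1) * k" for k using assms(1) by (cases l) simp_all
    then have "?q + copies \<le> card F + n div 2 - (if even n then 1 else 0)"
      using lower unfolding copies_def by metis
    then have "(n + 1) div 2 + copies \<le> card F"
      using assms(2) by (cases "even n") (simp_all, presburger+)
    then have h_eq: "?h = n + (n + 1) div 2 + (l - 1) * ?q"
      using le h by (simp add: copies_def)
    have "?q \<ge> 1" using assms(2) by linarith
    have "\<lceil>real n / 2\<rceil> = int ((n + 1) div 2)" "\<lceil>3 * real n / 2\<rceil> = int (n + (n + 1) div 2)"
      by (cases "even n"; auto elim!: evenE oddE simp: ceiling_eq_iff)+
    moreover have "int ((l - 1) * ?q) = (int l - 1) * (2 * int ((n + 1) div 2) - 1)"
      using assms(1) \<open>?q \<ge> 1\<close> by (simp only: of_nat_mult of_nat_diff) simp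
    ultimately show ?thesis using h_eq by simp
  qed
  ultimately show ?thesis by blast
qed

end
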